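(* Let $\mathcal{M}=(A,E)$ be the margin graph of a preference profile. The $\mathsf{FUN}$ algorithm described in the context, followed by returning the set of vertices that are cycle dominated or not dominated in the resulting diagram $\mathcal{M}^{\mathsf{FUN}}$, can be executed in time polynomial in $|A|$.
   Context: Elections: $A$ is a finite set of alternatives; a preference profile $\mathcal{P}=(\succ_1,\dots,\succ_n)$, $n\ge 1$, consists of linear orders on $A$. The margin is $m(x,y)=|\{i: x\succ_i y\}|-|\{i: y\succ_i x\}|$. The margin graph $\mathcal{M}(\mathcal{P})=(A,E)$ is the weighted directed graph with edge set $E=\{(x,y)\in A\times A: x\neq y,\ m(x,y)\ge 0\}$, edge $(x,y)$ having weight $m(x,y)$, given as adjacency lists. In a directed graph on $A$, a path from $u$ to $v$ is a sequence of distinct vertices $u=p_1,\dots,p_\ell=v$ with each $(p_i,p_{i+1})$ an edge; its strength is the minimum margin of its edges. Edge and vertex states: each edge of the diagram $F$ built below carries a state in $\{\mathsf{Fix},\mathsf{BC},\mathsf{CC},\mathsf{CBC}\}$. Relative to the current $F$, a vertex $y$ is: not dominated if it has no incoming edge; fixedly dominated if it has exactly one incoming edge and it has state $\mathsf{Fix}$, or it has at least one incoming edge of state $\mathsf{BC}$ or $\mathsf{CBC}$; cycle dominated if it has at least one incoming edge and all its incoming edges have state $\mathsf{CC}$. The $\mathsf{FUN}$ algorithm: initialize $F=(A,\emptyset)$. Process the edges $(x,y)\in E$ in order of decreasing margin (equal margins in arbitrary order). For the current edge with $k=m(x,y)$: (1) If $y$ is fixedly dominated and some $(z,y)\in F$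 has $m(z,y)>k$, reject $(x,y)$ and go to the next edge. (2) If $F$ contains a path from $y$ to $x$ of strength $>k$: let $U$ be the set of vertices having a path to $x$ in $F$ of strength $>k$; if for every $u\in U$ there is a path $P$ in $F$ from $y$ to $u$ of strength $>k$ such that for every edge $(c,d)$ on $P$ with state $\mathsf{CC}$, every path in $F$ from $d$ to $c$ of strength $\ge m(c,d)$ contains the vertex $y$, then reject $(x,y)$ and go to the next edge. (3) Otherwise assign a tentative state: if $y$ is not dominated, state $\mathsf{Fix}$; else if $y$ is cycle dominated and some $(z,y)\in F$ has $m(z,y)>k$, state $\mathsf{CBC}$; else if $y$ is cycle dominated and all $(z,y)\in F$ have $m(z,y)=k$, state $\mathsf{BC}$; else ($y$ fixedly dominated) state $\mathsf{BC}$ and change the state of the incoming $\mathsf{Fix}$ edge of $y$ (if any) to $\mathsf{BC}$. Add $(x,y)$ to $F$. (4) Let $C$ be the set of edges of $F$ lying on a directed cycle with $(x,y)$ (edges $(u,v)\in F$ with $u$ reachable from $y$ and $x$ reachable from $v$ in $F$). If $C\neq\emptyset$, set the state of $(x,y)$ to $\mathsf{CC}$ and set to $\mathsf{CC}$ the state of every $e\in C$ with $m(e)=k$. The final $F$ is $\mathcal{M}^{\mathsf{FUN}}$. *)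

theory Defs
  imports Complex_Main "HOL-Library.Extended_Real" "HOL-Computational_Algebra.Polynomial"
begin

section \<open>Elections and margin graphs\<close>

text \<open>Voter \<open>i\<close> strictly prefers \<open>x\<close> to \<open>y\<close> iff \<open>(x, y) \<in> P ! i\<close>.\<close>

definition profile :: "'a set \<Rightarrow> 'a rel list \<Rightarrow> bool" where
  "profile A P \<longleftrightarrow> P \<noteq> [] \<and> (\<forall>R \<in> set P. R \<subseteq> A \<times> A \<and> strict_linear_order_on A R)"

definition margin :: "'a rel list \<Rightarrow> 'a \<times> 'a \<Rightarrow> int" where
  "margin P = (\<lambda>(x, y).
     int (card {i. i < length P \<and> (x, y) \<in> P ! i}) - int (card {i. i < length P \<and> (y, x) \<in> P ! i}))"

definition margin_edges :: "'a set \<Rightarrow> 'a rel list \<Rightarrow> ('a \<times> 'a) set" where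
  "margin_edges A P = {(x, y). x \<in> A \<and> y \<in> A \<and> x \<noteq> y \<and> margin P (x, y) \<ge> 0}"


section \<open>The FUN algorithm\<close>

datatype estate = Fix | BC | CC | CBC

text \<open>A diagram maps each of its edges to the state of that edge; its edge set is \<open>dom F\<close>.\<close>

type_synonym 'a diagram = "'a \<times> 'a \<Rightarrow> estate option"

definition path_edges :: "'a list \<Rightarrow> ('a \<times> 'a) set" where
  "path_edges p = set (zip p (tl p))"

definition is_path :: "'a diagram \<Rightarrow> 'a \<Rightarrow> 'a list \<Rightarrow> 'a \<Rightarrow> bool" where
  "is_path F u p v \<longleftrightarrow>
     p \<noteq> [] \<and> distinct p \<and> hd p = u \<and> last p = v \<and> path_edges p \<subseteq> dom F"

text \<open>The one-vertex path has no edges; its strength is \<open>\<infinity>\<close>.\<close>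

definition strength :: "('a \<times> 'a \<Rightarrow> int) \<Rightarrow> 'a list \<Rightarrow> ereal" where
  "strength m p = Min (insert \<infinity> ((\<lambda>e. ereal (real_of_int (m e))) ` path_edges p))"

definition incoming :: "'a diagram \<Rightarrow> 'a \<Rightarrow> ('a \<times> 'a) set" where
  "incoming F y = {e \<in> dom F. snd e = y}"

definition not_dominated :: "'a diagram \<Rightarrow> 'a \<Rightarrow> bool" where
  "not_dominated F y \<longleftrightarrow> incoming F y = {}"

definition fixedly_dominated :: "'a diagram \<Rightarrow> 'a \<Rightarrow> bool" where
  "fixedly_dominated F y \<longleftrightarrow>
     (\<exists>e. incoming F y = {e} \<and> F e = Some Fix) \<or>
     (\<exists>e \<in> incoming F y. F e = Some BC \<or> F e = Some CBC)"

definition cycle_dominated :: "'a diagram \<Rightarrow> 'a \<Rightarrow> bool" where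
  "cycle_dominated F y \<longleftrightarrow> incoming F y \<noteq> {} \<and> (\<forall>e \<in> incoming F y. F e = Some CC)"

definition reject_dominated :: "('a \<times> 'a \<Rightarrow> int) \<Rightarrow> 'a diagram \<Rightarrow> 'a \<Rightarrow> 'a \<Rightarrow> bool" where
  "reject_dominated m F x y \<longleftrightarrow>
     fixedly_dominated F y \<and> (\<exists>e \<in> incoming F y. m e > m (x, y))"

definition reject_cycle :: "'a set \<Rightarrow> ('a \<times> 'a \<Rightarrow> int) \<Rightarrow> 'a diagram \<Rightarrow> 'a \<Rightarrow> 'a \<Rightarrow> bool" where
  "reject_cycle A m F x y \<longleftrightarrow>
     (let k = ereal (real_of_int (m (x, y)));
          U = {u \<in> A. \<exists>p. is_path F u p x \<and> strength m p > k}
      in (\<exists>p. is_path F y p x \<and> strength m p > k) \<and>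
         (\<forall>u \<in> U. \<exists>p. is_path F y p u \<and> strength m p > k \<and>
            (\<forall>(c, d) \<in> path_edges p. F (c, d) = Some CC \<longrightarrow>
               (\<forall>q. is_path F d q c \<and> strength m q \<ge> ereal (real_of_int (m (c, d)))
                  \<longrightarrow> y \<in> set q))))"

definition add_edge :: "('a \<times> 'a \<Rightarrow> int) \<Rightarrow> 'a diagram \<Rightarrow> 'a \<Rightarrow> 'a \<Rightarrow> 'a diagram" where
  "add_edge m F x y =
     (let k = m (x, y) in
      if not_dominated F y then F((x, y) \<mapsto> Fix)
      else if cycle_dominated F y \<and> (\<exists>e \<in> incoming F y. m e > k) then F((x, y) \<mapsto> CBC)
      else if cycle_dominated F y \<and> (\<forall>e \<in> incoming F y. m e = k) then F((x, y) \<mapsto> BC)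
      else (\<lambda>e. if e \<in> incoming F y \<and> F e = Some Fix then Some BC else F e)((x, y) \<mapsto> BC))"

definition cycle_edges :: "'a diagram \<Rightarrow> 'a \<Rightarrow> 'a \<Rightarrow> ('a \<times> 'a) set" where
  "cycle_edges F x y = {(u, v) \<in> dom F. (y, u) \<in> (dom F)\<^sup>* \<and> (v, x) \<in> (dom F)\<^sup>*}"

definition mark_cycles :: "('a \<times> 'a \<Rightarrow> int) \<Rightarrow> 'a diagram \<Rightarrow> 'a \<Rightarrow> 'a \<Rightarrow> 'a diagram" where
  "mark_cycles m F x y =
     (if cycle_edges F x y = {} then F
      else (\<lambda>e. if e = (x, y) \<or> e \<in> cycle_edges F x y \<and> m e = m (x, y) then Some CC else F e))"

definition fun_step :: "'a set \<Rightarrow> ('a \<times> 'a \<Rightarrow> int) \<Rightarrow> 'a \<times> 'a \<Rightarrow> 'a diagram \<Rightarrow> 'a diagram" where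
  "fun_step A m = (\<lambda>(x, y) F.
     if reject_dominated m F x y then F
     else if reject_cycle A m F x y then F
     else mark_cycles m (add_edge m F x y) x y)"

definition fun_diagram :: "'a set \<Rightarrow> ('a \<times> 'a \<Rightarrow> int) \<Rightarrow> ('a \<times> 'a) list \<Rightarrow> 'a diagram" where
  "fun_diagram A m es = fold (fun_step A m) es Map.empty"

definition winners :: "'a set \<Rightarrow> 'a diagram \<Rightarrow> 'a set" where
  "winners A F = {y \<in> A. cycle_dominated F y \<or> not_dominated F y}"

text \<open>
  The list \<open>es\<close> enumerates \<open>E\<close> by decreasing margin, edges of equal margin being ordered by
  \<open>rank\<close>.  An injective \<open>rank\<close> prescribes any desired tie-breaking; a constant \<open>rank\<close> imposes
  no condition on ties at all.
\<close>

definition processing_order ::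
  "('a \<times> 'a \<Rightarrow> int) \<Rightarrow> ('a \<times> 'a) set \<Rightarrow> ('a \<times> 'a \<Rightarrow> int) \<Rightarrow> ('a \<times> 'a) list \<Rightarrow> bool" where
  "processing_order m E rank es \<longleftrightarrow>
     distinct es \<and> set es = E \<and>
     sorted_wrt (\<lambda>e f. m e > m f \<or> m e = m f \<and> rank e \<le> rank f) es"


section \<open>A random access machine with unit costs\<close>

text \<open>
  While programs over finitely many integer arrays (a scalar is an array used at one index only).
  Arithmetic is restricted to addition and subtraction: with these, numbers grow by at most one
  bit per operation, so that unit costs are a realistic measure, whereas unit-cost multiplication
  would not be.  Every syntax node that is evaluated costs one unit of time.
\<close>

type_synonym vname = string
type_synonym state = "vname \<Rightarrow> int \<Rightarrow> int"

datatype aexp = Const int | Get vname aexp | Add aexp aexp | Sub aexp aexp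
datatype bexp = Less aexp aexp | Neg bexp | Conj bexp bexp
datatype com = Skip | Put vname aexp aexp | Seq com com | Cond bexp com com | While bexp com

fun aval :: "aexp \<Rightarrow> state \<Rightarrow> int" where
  "aval (Const z) s = z"
| "aval (Get a e) s = s a (aval e s)"
| "aval (Add e f) s = aval e s + aval f s"
| "aval (Sub e f) s = aval e s - aval f s"

fun acost :: "aexp \<Rightarrow> nat" where
  "acost (Const z) = 1"
| "acost (Get a e) = 1 + acost e"
| "acost (Add e f) = 1 + acost e + acost f"
| "acost (Sub e f) = 1 + acost e + acost f"

fun bval :: "bexp \<Rightarrow> state \<Rightarrow> bool" where
  "bval (Less e f) s \<longleftrightarrow> aval e s < aval f s"
| "bval (Neg b) s \<longleftrightarrow> \<not> bval b s"
| "bval (Conj b c) s \<longleftrightarrow> bval b s \<and> bval c s"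

fun bcost :: "bexp \<Rightarrow> nat" where
  "bcost (Less e f) = 1 + acost e + acost f"
| "bcost (Neg b) = 1 + bcost b"
| "bcost (Conj b c) = 1 + bcost b + bcost c"

text \<open>\<open>exec c s t s'\<close>: started in \<open>s\<close>, program \<open>c\<close> halts after \<open>t\<close> time units in state \<open>s'\<close>.\<close>

inductive exec :: "com \<Rightarrow> state \<Rightarrow> nat \<Rightarrow> state \<Rightarrow> bool" where
  Skip: "exec Skip s 1 s"
| Put: "exec (Put a i e) s (1 + acost i + acost e) (s(a := (s a)(aval i s := aval e s)))"
| Seq: "exec c s t s' \<Longrightarrow> exec d s' t' s'' \<Longrightarrow> exec (Seq c d) s (1 + t + t') s''"
| CondTrue: "bval b s \<Longrightarrow> exec c s t s' \<Longrightarrow> exec (Cond b c d) s (1 + bcost b + t) s'"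
| CondFalse: "\<not> bval b s \<Longrightarrow> exec d s t s' \<Longrightarrow> exec (Cond b c d) s (1 + bcost b + t) s'"
| WhileFalse: "\<not> bval b s \<Longrightarrow> exec (While b c) s (1 + bcost b) s"
| WhileTrue: "bval b s \<Longrightarrow> exec c s t s' \<Longrightarrow> exec (While b c) s' t' s'' \<Longrightarrow>
    exec (While b c) s (1 + bcost b + t + t') s''"

inductive_cases exec_SkipE: "exec Skip s t s'"
inductive_cases exec_PutE: "exec (Put a i e) s t s'"
inductive_cases exec_SeqE: "exec (Seq c d) s t s'"
inductive_cases exec_CondE: "exec (Cond b c d) s t s'"
inductive_cases exec_WhileE: "exec (While b c) s t s'"

text \<open>Since programs are deterministic, the existence of a run determines time and result.\<close>

lemma exec_deterministic:
  "exec c s t s' \<Longrightarrow> exec c s r u \<Longrightarrow> t = r \<and> s' = u"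
proof (induction arbitrary: r u rule: exec.induct)
  case Skip then show ?case by (auto elim: exec_SkipE)
next
  case Put then show ?case by (auto elim: exec_PutE)
next
  case (Seq c s t s' d t' s'')
  from Seq.prems obtain t1 u1 t2 where
    "exec c s t1 u1" "exec d u1 t2 u" "r = 1 + t1 + t2" by (auto elim: exec_SeqE)
  with Seq.IH show ?case by metis
next
  case (CondTrue b s c t s' d)
  from CondTrue.prems CondTrue.hyps(1) obtain t1 where
    "exec c s t1 u" "r = 1 + bcost b + t1" by (auto elim: exec_CondE)
  with CondTrue.IH show ?case by metis
next
  case (CondFalse b s d t s' c)
  from CondFalse.prems CondFalse.hyps(1) obtain t1 where
    "exec d s t1 u" "r = 1 + bcost b + t1" by (auto elim: exec_CondE)
  with CondFalse.IH show ?case by metis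
next
  case WhileFalse then show ?case by (auto elim: exec_WhileE)
next
  case (WhileTrue b s c t s' t' s'')
  from WhileTrue.prems WhileTrue.hyps(1) obtain t1 u1 t2 where
    "exec c s t1 u1" "exec (While b c) u1 t2 u" "r = 1 + bcost b + t1 + t2"
    by (auto elim: exec_WhileE)
  with WhileTrue.IH show ?case by metis
qed


section \<open>Input and output\<close>

text \<open>
  The alternatives are numbered by a bijection \<open>v\<close> from \<open>{..<card A}\<close> to \<open>A\<close>; \<open>adj i\<close> is the
  adjacency list of vertex number \<open>i\<close>, listing the heads of its outgoing edges in any order.
\<close>

definition adjacency_lists ::
  "'a set \<Rightarrow> ('a \<times> 'a) set \<Rightarrow> (nat \<Rightarrow> 'a) \<Rightarrow> (nat \<Rightarrow> nat list) \<Rightarrow> bool" where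
  "adjacency_lists A E v adj \<longleftrightarrow>
     bij_betw v {..<card A} A \<and>
     (\<forall>i < card A. distinct (adj i) \<and> set (adj i) = {j. j < card A \<and> (v i, v j) \<in> E})"

definition along_adj :: "nat \<Rightarrow> (nat \<Rightarrow> nat list) \<Rightarrow> (nat \<Rightarrow> nat \<Rightarrow> 'b) \<Rightarrow> 'b list" where
  "along_adj n adj f = concat (map (\<lambda>i. map (f i) (adj i)) [0..<n])"

definition array_of :: "int list \<Rightarrow> int \<Rightarrow> int" where
  "array_of xs i = (if 0 \<le> i \<and> nat i < length xs then xs ! nat i else 0)"

text \<open>
  The adjacency lists are stored one after the other: that of vertex \<open>i\<close> occupies the positions
  from \<open>off[i]\<close> up to, but not including, \<open>off[i + 1]\<close> of the arrays \<open>head\<close> and \<open>weight\<close>.  The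
  tie-breaking ranks are stored likewise.  All other memory is zero; hence a constantly zero
  \<open>rank\<close> means that the margin graph is the only input.
\<close>

definition input_state ::
  "nat \<Rightarrow> (nat \<Rightarrow> 'a) \<Rightarrow> (nat \<Rightarrow> nat list) \<Rightarrow> ('a \<times> 'a \<Rightarrow> int) \<Rightarrow> ('a \<times> 'a \<Rightarrow> int) \<Rightarrow> state" where
  "input_state n v adj m rank = (\<lambda>_ _. 0)
     (''n'' := array_of [int n],
      ''off'' := array_of (map (\<lambda>i. \<Sum>l<i. int (length (adj l))) [0..<Suc n]),
      ''head'' := array_of (along_adj n adj (\<lambda>i j. int j)),
      ''weight'' := array_of (along_adj n adj (\<lambda>i j. m (v i, v j))),
      ''rank'' := array_of (along_adj n adj (\<lambda>i j. rank (v i, v j))))"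

fun state_code :: "estate option \<Rightarrow> int" where
  "state_code None = 0"
| "state_code (Some Fix) = 1"
| "state_code (Some BC) = 2"
| "state_code (Some CC) = 3"
| "state_code (Some CBC) = 4"

definition outputs_diagram ::
  "nat \<Rightarrow> (nat \<Rightarrow> 'a) \<Rightarrow> (nat \<Rightarrow> nat list) \<Rightarrow> state \<Rightarrow> 'a diagram \<Rightarrow> bool" where
  "outputs_diagram n v adj s F \<longleftrightarrow>
     (let cs = along_adj n adj (\<lambda>i j. state_code (F (v i, v j)))
      in \<forall>q < length cs. s ''state'' (int q) = cs ! q)"

definition outputs_set :: "nat \<Rightarrow> (nat \<Rightarrow> 'a) \<Rightarrow> state \<Rightarrow> 'a set \<Rightarrow> bool" where
  "outputs_set n v s W \<longleftrightarrow>
     (\<forall>i < n. s ''winner'' (int i) = (if v i \<in> W then 1 else 0))"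

end

theory Submission
  imports Defs
begin

text \<open>
  The only superpolynomial ingredient of the algorithm is its quantification over simple paths,
  and all of it reduces to reachability. A bound on the strength of a path bounds each of its
  edges separately, and a walk through edges of a given set contains a simple path through such
  edges. In the second rejection test, whether an edge \<open>(c, d)\<close> of state \<open>CC\<close> may be used depends
  only on \<open>y\<close>: it is forbidden iff \<open>c\<close> can be reached from \<open>d\<close> by edges of margin at least
  \<open>m (c, d)\<close> avoiding \<open>y\<close>. The test therefore asks for reachability in the graph of permitted edges.

  On the machine, the algorithm becomes a nest of loops over the vertices. Each of \<open>n\<^sup>2\<close> sweeps over
  all pairs of vertices processes every edge that is strongest among the remaining ones at the
  moment when it is met, hence at least one as long as an edge remains.
\<close>

section \<open>Bounded loops\<close>

text \<open>A time bound proved next to every correctness argument would double the work. Time is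
  instead a property of syntax: the cost of an array program is a polynomial in the number of
  vertices, read off its text, and one theorem about the compiler carries it over to the machine.
  The array language can compare stored numbers and constants but does no arithmetic on them, since
  the algorithm only compares margins; additions on the machine come from counters and addresses
  alone. The running time therefore does not depend on the number of voters or on the size of the
  margins.

  No sorting is verified either. Margins and ranks may tie, so no list of edges is fixed in advance:
  an invariant carries the list of edges processed so far, and the processing order is extracted
  from the finished run. What margin and rank leave open is settled by the order in which a sweep
  meets the pairs of vertices.\<close>

definition for_loop :: "nat \<Rightarrow> com \<Rightarrow> com" where
  "for_loop k c = Seq (Put ''i'' (Const (int k)) (Const 0))
     (While (Less (Get ''i'' (Const (int k))) (Get ''n'' (Const 0)))
       (Seq c (Put ''i'' (Const (int k)) (Add (Get ''i'' (Const (int k))) (Const 1)))))"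

definition set_index :: "nat \<Rightarrow> nat \<Rightarrow> state \<Rightarrow> state" where
  "set_index k j s = s(''i'' := (s ''i'')(int k := int j))"

lemma set_index_simps [simp]:
  "a \<noteq> ''i'' \<Longrightarrow> set_index k j s a = s a"
  "set_index k j s ''i'' z = (if z = int k then int j else s ''i'' z)"
  by (auto simp: set_index_def)

text \<open>A total-correctness triple with a time budget. Only an upper bound is tracked, so
  budgets can be rounded up freely.\<close>

definition terminates :: "com \<Rightarrow> state \<Rightarrow> nat \<Rightarrow> (state \<Rightarrow> bool) \<Rightarrow> bool" where
  "terminates c s T Q \<longleftrightarrow> (\<exists>t s'. exec c s t s' \<and> t \<le> T \<and> Q s')"

lemma terminates_mono:
  "terminates c s T Q \<Longrightarrow> T \<le> T' \<Longrightarrow> (\<And>s'. Q s' \<Longrightarrow> Q' s') \<Longrightarrow> terminates c s T' Q'"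
  unfolding terminates_def by (meson order_trans)

lemma terminates_Skip: "Q s \<Longrightarrow> terminates Skip s 1 Q"
  unfolding terminates_def using exec.Skip by blast

lemma terminates_Put:
  "Q (s(a := (s a)(aval i s := aval e s))) \<Longrightarrow> terminates (Put a i e) s (1 + acost i + acost e) Q"
  unfolding terminates_def using exec.Put by blast

lemma terminates_Seq:
  assumes "terminates c s T R" and "\<And>s'. R s' \<Longrightarrow> terminates d s' T' Q"
  shows "terminates (Seq c d) s (1 + T + T') Q"
proof -
  from assms(1) obtain t s' where 1: "exec c s t s'" "t \<le> T" "R s'"
    by (auto simp: terminates_def)
  from assms(2)[OF 1(3)] obtain t' s'' where 2: "exec d s' t' s''" "t' \<le> T'" "Q s''"
    by (auto simp: terminates_def)
  from exec.Seq[OF 1(1) 2(1)] 1 2 show ?thesis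
    unfolding terminates_def by (intro exI[of _ "1 + t + t'"] exI[of _ s'']) auto
qed

text \<open>The budgets of the two branches are added rather than maximised: a sum of polynomials is
  a polynomial, a maximum in general is not.\<close>

lemma terminates_Cond:
  assumes "bval b s \<Longrightarrow> terminates c s T Q" and "\<not> bval b s \<Longrightarrow> terminates d s T' Q"
  shows "terminates (Cond b c d) s (1 + bcost b + T + T') Q"
proof (cases "bval b s")
  case True
  with assms(1) obtain t s' where 1: "exec c s t s'" "t \<le> T" "Q s'"
    by (auto simp: terminates_def)
  from exec.CondTrue[OF True 1(1)] 1 show ?thesis
    unfolding terminates_def by (intro exI[of _ "1 + bcost b + t"] exI[of _ s']) auto
next
  case False
  with assms(2) obtain t s' where 1: "exec d s t s'" "t \<le> T'" "Q s'"
    by (auto simp: terminates_def)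
  from exec.CondFalse[OF False 1(1)] 1 show ?thesis
    unfolding terminates_def by (intro exI[of _ "1 + bcost b + t"] exI[of _ s']) auto
qed

text \<open>Counter number k is cell k of \<open>''i''\<close>, and the body must return with that
  cell intact. The constant 10 pays for initialising the counter (3), the last, failing test (6) and
  a sequencing node; 13 pays for a test (6), the increment (6) and the sequencing node of one round.
  The invariant is demanded of the state after the increment, hence the \<open>set_index\<close> in
  \<open>step\<close>.\<close>

lemma terminates_for_loop:
  assumes init: "I 0 (set_index k 0 s)"
    and n: "\<And>j s. I j s \<Longrightarrow> s ''n'' 0 = int n"
    and i: "\<And>j s. I j s \<Longrightarrow> s ''i'' (int k) = int j"
    and step: "\<And>j s. j < n \<Longrightarrow> I j s \<Longrightarrow>
      terminates c s T (\<lambda>s'. s' ''i'' (int k) = int j \<and> I (Suc j) (set_index k (Suc j) s'))"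
  shows "terminates (for_loop k c) s (10 + n * (T + 13)) (I n)"
proof -
  define b where "b = Less (Get ''i'' (Const (int k))) (Get ''n'' (Const 0))"
  define d where "d = Seq c (Put ''i'' (Const (int k)) (Add (Get ''i'' (Const (int k))) (Const 1)))"
  have d: "terminates d s (1 + T + 6) (I (Suc j))" if "j < n" "I j s" for j s
    unfolding d_def
  proof (rule terminates_Seq[OF step[OF that]])
    fix s' assume "s' ''i'' (int k) = int j \<and> I (Suc j) (set_index k (Suc j) s')"
    then show "terminates (Put ''i'' (Const (int k)) (Add (Get ''i'' (Const (int k))) (Const 1)))
        s' 6 (I (Suc j))"
      by (intro terminates_mono[OF terminates_Put[where Q = "I (Suc j)"]])
        (auto simp: set_index_def add.commute)
  qed
  have loop: "j \<le> n \<Longrightarrow> I j s \<Longrightarrow> terminates (While b d) s (6 + (n - j) * (T + 13)) (I n)" for j s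
  proof (induction "n - j" arbitrary: j s)
    case 0
    then have j: "j = n" by simp
    have "\<not> bval b s" using 0 n[of j s] i[of j s] j by (simp add: b_def)
    from exec.WhileFalse[OF this] 0 j show ?case
      unfolding terminates_def by (intro exI[of _ "1 + bcost b"] exI[of _ s]) (auto simp: b_def)
  next
    case (Suc l)
    then have j: "j < n" by simp
    have b: "bval b s" using Suc.prems n[of j s] i[of j s] j by (simp add: b_def)
    from d[OF j Suc.prems(2)] obtain t s' where 1: "exec d s t s'" "t \<le> T + 7" "I (Suc j) s'"
      by (auto simp: terminates_def)
    have "l = n - Suc j" using Suc.hyps(2) by simp
    from Suc.hyps(1)[OF this _ 1(3)] j obtain t' s''
      where 2: "exec (While b d) s' t' s''" "t' \<le> 6 + (n - Suc j) * (T + 13)" "I n s''"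
      by (auto simp: terminates_def)
    have "n - j = Suc (n - Suc j)" using j by simp
    then have "1 + bcost b + t + t' \<le> 6 + (n - j) * (T + 13)"
      using 1 2 by (simp add: b_def)
    with exec.WhileTrue[OF b 1(1) 2(1)] 2(3) show ?case unfolding terminates_def by blast
  qed
  have "terminates (for_loop k c) s (1 + 3 + (6 + (n - 0) * (T + 13))) (I n)"
    unfolding for_loop_def b_def[symmetric] d_def[symmetric]
  proof (rule terminates_Seq[where R = "I 0"])
    show "terminates (Put ''i'' (Const (int k)) (Const 0)) s 3 (I 0)"
      using init by (intro terminates_mono[OF terminates_Put[where Q = "I 0"]])
        (auto simp: set_index_def)
  qed (use loop[of 0] in simp)
  then show ?thesis by simp
qed


section \<open>A first-order array language\<close>

text \<open>
  Programs over square matrices whose only loops run over all vertices. Such programs are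
  polynomial by construction, so that after compilation no time bound has to be proved by hand.
  Index variables are numbered; the variables bound along a branch must be distinct.
\<close>

datatype mat = Weight | Rank | Todo | State | Reach1 | Reach2 | Reach3 | Bad | Winner

datatype tm = Num int | Cell mat nat nat
datatype fm = FLess tm tm | FSame nat nat | FNot fm | FAnd fm fm | FEx nat fm
datatype prog = PSkip | PSet mat nat nat tm | PSeq prog prog | PIf fm prog prog | PFor nat prog

type_synonym env = "nat \<Rightarrow> nat"
type_synonym mats = "mat \<Rightarrow> nat \<Rightarrow> nat \<Rightarrow> int"

fun tval :: "tm \<Rightarrow> env \<Rightarrow> mats \<Rightarrow> int" where
  "tval (Num z) \<rho> M = z"
| "tval (Cell a i j) \<rho> M = M a (\<rho> i) (\<rho> j)"

fun fval :: "nat \<Rightarrow> fm \<Rightarrow> env \<Rightarrow> mats \<Rightarrow> bool" where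
  "fval n (FLess t u) \<rho> M \<longleftrightarrow> tval t \<rho> M < tval u \<rho> M"
| "fval n (FSame i j) \<rho> M \<longleftrightarrow> \<rho> i = \<rho> j"
| "fval n (FNot f) \<rho> M \<longleftrightarrow> \<not> fval n f \<rho> M"
| "fval n (FAnd f g) \<rho> M \<longleftrightarrow> fval n f \<rho> M \<and> fval n g \<rho> M"
| "fval n (FEx i f) \<rho> M \<longleftrightarrow> (\<exists>k<n. fval n f (\<rho>(i := k)) M)"

fun psem :: "nat \<Rightarrow> prog \<Rightarrow> env \<Rightarrow> mats \<Rightarrow> mats" where
  "psem n PSkip \<rho> M = M"
| "psem n (PSet a i j t) \<rho> M = M(a := (M a)(\<rho> i := (M a (\<rho> i))(\<rho> j := tval t \<rho> M)))"
| "psem n (PSeq p q) \<rho> M = psem n q \<rho> (psem n p \<rho> M)"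
| "psem n (PIf f p q) \<rho> M = (if fval n f \<rho> M then psem n p \<rho> M else psem n q \<rho> M)"
| "psem n (PFor i p) \<rho> M = fold (\<lambda>k. psem n p (\<rho>(i := k))) [0..<n] M"

fun twf :: "nat set \<Rightarrow> tm \<Rightarrow> bool" where
  "twf X (Num z) \<longleftrightarrow> True"
| "twf X (Cell a i j) \<longleftrightarrow> i \<in> X \<and> j \<in> X"

fun fwf :: "nat set \<Rightarrow> fm \<Rightarrow> bool" where
  "fwf X (FLess t u) \<longleftrightarrow> twf X t \<and> twf X u"
| "fwf X (FSame i j) \<longleftrightarrow> i \<in> X \<and> j \<in> X"
| "fwf X (FNot f) \<longleftrightarrow> fwf X f"
| "fwf X (FAnd f g) \<longleftrightarrow> fwf X f \<and> fwf X g"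
| "fwf X (FEx i f) \<longleftrightarrow> i \<notin> X \<and> fwf (insert i X) f"

fun pwf :: "nat set \<Rightarrow> prog \<Rightarrow> bool" where
  "pwf X PSkip \<longleftrightarrow> True"
| "pwf X (PSet a i j t) \<longleftrightarrow> i \<in> X \<and> j \<in> X \<and> twf X t"
| "pwf X (PSeq p q) \<longleftrightarrow> pwf X p \<and> pwf X q"
| "pwf X (PIf f p q) \<longleftrightarrow> fwf X f \<and> pwf X p \<and> pwf X q"
| "pwf X (PFor i p) \<longleftrightarrow> i \<notin> X \<and> pwf (insert i X) p"

fun mat_name :: "mat \<Rightarrow> vname" where
  "mat_name Weight = ''W''"
| "mat_name Rank = ''R''"
| "mat_name Todo = ''T''"
| "mat_name State = ''S''"
| "mat_name Reach1 = ''R1''"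
| "mat_name Reach2 = ''R2''"
| "mat_name Reach3 = ''R3''"
| "mat_name Bad = ''B''"
| "mat_name Winner = ''V''"

lemma mat_name_eq_iff [simp]: "mat_name a = mat_name b \<longleftrightarrow> a = b"
  by (cases a; cases b) simp_all

lemma mat_name_neq [simp]:
  "mat_name a \<noteq> ''n''" "mat_name a \<noteq> ''off''" "mat_name a \<noteq> ''head''" "mat_name a \<noteq> ''weight''"
  "mat_name a \<noteq> ''rank''" "mat_name a \<noteq> ''row''" "mat_name a \<noteq> ''i''" "mat_name a \<noteq> ''acc''"
  "mat_name a \<noteq> ''res''" "mat_name a \<noteq> ''state''" "mat_name a \<noteq> ''winner''"
  by (cases a; simp)+

lemmas mat_name_neq_sym [simp] = mat_name_neq[symmetric]

text \<open>
  A matrix is stored row by row. As the machine cannot multiply, the position of the first entry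
  of row \<open>i\<close> is looked up in the array \<open>row\<close>.
\<close>

definition index :: "nat \<Rightarrow> aexp" where
  "index i = Get ''i'' (Const (int i))"

definition position :: "aexp \<Rightarrow> aexp \<Rightarrow> aexp" where
  "position e f = Add (Get ''row'' e) f"

fun compile_tm :: "tm \<Rightarrow> aexp" where
  "compile_tm (Num z) = Const z"
| "compile_tm (Cell a i j) = Get (mat_name a) (position (index i) (index j))"

definition set_result :: "bexp \<Rightarrow> com" where
  "set_result b = Cond b (Put ''res'' (Const 0) (Const 1)) (Put ''res'' (Const 0) (Const 0))"

definition result_true :: bexp where
  "result_true = Less (Const 0) (Get ''res'' (Const 0))"

text \<open>Machine expressions have no quantifiers, so a formula becomes a program that leaves its
  truth value in \<open>''res''\<close>. Subformulas overwrite that cell; a quantifier therefore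
  collects its disjunction in its own cell of \<open>''acc''\<close>. If the first conjunct fails,
  the 0 it left behind is already the answer.\<close>

fun compile_fm :: "fm \<Rightarrow> com" where
  "compile_fm (FLess t u) = set_result (Less (compile_tm t) (compile_tm u))"
| "compile_fm (FSame i j) =
     set_result (Conj (Neg (Less (index i) (index j))) (Neg (Less (index j) (index i))))"
| "compile_fm (FNot f) = Seq (compile_fm f) (set_result (Neg result_true))"
| "compile_fm (FAnd f g) = Seq (compile_fm f) (Cond result_true (compile_fm g) Skip)"
| "compile_fm (FEx i f) = Seq (Put ''acc'' (Const (int i)) (Const 0))
     (Seq (for_loop i (Seq (compile_fm f)
        (Cond result_true (Put ''acc'' (Const (int i)) (Const 1)) Skip)))
     (set_result (Less (Const 0) (Get ''acc'' (Const (int i))))))"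

fun compile :: "prog \<Rightarrow> com" where
  "compile PSkip = Skip"
| "compile (PSet a i j t) = Put (mat_name a) (position (index i) (index j)) (compile_tm t)"
| "compile (PSeq p q) = Seq (compile p) (compile q)"
| "compile (PIf f p q) = Seq (compile_fm f) (Cond result_true (compile p) (compile q))"
| "compile (PFor i p) = for_loop i (compile p)"

text \<open>The constant 100 simply exceeds every local overhead that occurs. The polynomial
  \<open>[:0, 1:]\<close> is the indeterminate, so each quantifier contributes a factor n.\<close>

fun fm_cost :: "fm \<Rightarrow> nat poly" where
  "fm_cost (FLess t u) = [:100:]"
| "fm_cost (FSame i j) = [:100:]"
| "fm_cost (FNot f) = fm_cost f + [:100:]"
| "fm_cost (FAnd f g) = fm_cost f + fm_cost g + [:100:]"
| "fm_cost (FEx i f) = [:100:] + [:0, 1:] * (fm_cost f + [:100:])"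

fun prog_cost :: "prog \<Rightarrow> nat poly" where
  "prog_cost PSkip = [:100:]"
| "prog_cost (PSet a i j t) = [:100:]"
| "prog_cost (PSeq p q) = prog_cost p + prog_cost q + [:100:]"
| "prog_cost (PIf f p q) = fm_cost f + prog_cost p + prog_cost q + [:100:]"
| "prog_cost (PFor i p) = [:100:] + [:0, 1:] * (prog_cost p + [:100:])"

definition represents :: "nat \<Rightarrow> nat set \<Rightarrow> env \<Rightarrow> mats \<Rightarrow> state \<Rightarrow> bool" where
  "represents n X \<rho> M s \<longleftrightarrow>
     s ''n'' 0 = int n \<and>
     (\<forall>i<n. s ''row'' (int i) = int (i * n)) \<and>
     (\<forall>k\<in>X. \<rho> k < n \<and> s ''i'' (int k) = int (\<rho> k)) \<and>
     (\<forall>a. \<forall>i<n. \<forall>j<n. s (mat_name a) (int (i * n + j)) = M a i j)"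

text \<open>The cells of variables in X belong to enclosing loops and quantifiers and must survive;
  the cells of variables bound inside the formula may change.\<close>

definition formula_frame :: "nat set \<Rightarrow> state \<Rightarrow> state \<Rightarrow> bool" where
  "formula_frame X s s' \<longleftrightarrow>
     (\<forall>a. a \<noteq> ''i'' \<longrightarrow> a \<noteq> ''acc'' \<longrightarrow> a \<noteq> ''res'' \<longrightarrow> s' a = s a) \<and>
     (\<forall>k\<in>X. s' ''i'' (int k) = s ''i'' (int k) \<and> s' ''acc'' (int k) = s ''acc'' (int k))"

text \<open>Its purpose is the survival of the input arrays. Matrices and the counters in scope are
  accounted for by \<open>represents\<close>.\<close>

definition prog_frame :: "state \<Rightarrow> state \<Rightarrow> bool" where
  "prog_frame s s' \<longleftrightarrow>
     (\<forall>a. a \<noteq> ''i'' \<longrightarrow> a \<noteq> ''acc'' \<longrightarrow> a \<noteq> ''res'' \<longrightarrow> a \<notin> range mat_name \<longrightarrow> s' a = s a)"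

section \<open>Correctness and running time of the compiler\<close>

lemma formula_frame_trans: "formula_frame X s s' \<Longrightarrow> formula_frame X s' s'' \<Longrightarrow> formula_frame X s s''"
  by (simp add: formula_frame_def)

lemma represents_formula_frame:
  "represents n X \<rho> M s \<Longrightarrow> formula_frame X s s' \<Longrightarrow> represents n X \<rho> M s'"
  by (simp add: formula_frame_def represents_def)

lemma formula_frame_prog_frame: "formula_frame X s s' \<Longrightarrow> prog_frame s s'"
  by (simp add: formula_frame_def prog_frame_def)

lemma prog_frame_refl: "prog_frame s s"
  by (simp add: prog_frame_def)

lemma prog_frame_trans: "prog_frame s s' \<Longrightarrow> prog_frame s' s'' \<Longrightarrow> prog_frame s s''"
  by (simp add: prog_frame_def)

lemma position_inj:
  fixes i j k l n :: nat
  assumes "j < n" "l < n"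
  shows "i * n + j = k * n + l \<longleftrightarrow> i = k \<and> j = l"
proof
  assume eq: "i * n + j = k * n + l"
  from arg_cong[OF eq, of "\<lambda>z. z div n"] arg_cong[OF eq, of "\<lambda>z. z mod n"] assms
  show "i = k \<and> j = l" by simp
qed simp

lemma aval_index: "represents n X \<rho> M s \<Longrightarrow> k \<in> X \<Longrightarrow> aval (index k) s = int (\<rho> k)"
  by (simp add: represents_def index_def)

lemma aval_position:
  assumes "represents n X \<rho> M s" "i \<in> X" "j \<in> X"
  shows "aval (position (index i) (index j)) s = int (\<rho> i * n + \<rho> j)"
  using assms by (simp add: represents_def index_def position_def)

lemma aval_compile_tm: "represents n X \<rho> M s \<Longrightarrow> twf X t \<Longrightarrow> aval (compile_tm t) s = tval t \<rho> M"
proof (cases t)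
  case (Cell a i j)
  assume "represents n X \<rho> M s" "twf X t"
  with Cell show ?thesis
    using aval_position[of n X \<rho> M s i j] by (simp add: represents_def del: of_nat_add of_nat_mult)
qed simp

lemma acost_compile_tm: "acost (compile_tm t) \<le> 10"
  by (cases t) (simp_all add: index_def position_def)

lemma terminates_set_result:
  assumes "bval b s = B"
  shows "terminates (set_result b) s (10 + bcost b)
    (\<lambda>s'. formula_frame X s s' \<and> s' ''res'' 0 = of_bool B)"
  unfolding set_result_def using assms
  by (intro terminates_mono[OF terminates_Cond[OF terminates_Put terminates_Put]])
    (auto simp: formula_frame_def)

lemma terminates_compile_fm:
  "represents n X \<rho> M s \<Longrightarrow> fwf X f \<Longrightarrow>
    terminates (compile_fm f) s (poly (fm_cost f) n)
      (\<lambda>s'. formula_frame X s s' \<and> s' ''res'' 0 = of_bool (fval n f \<rho> M))"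
proof (induction f arbitrary: X \<rho> s)
  case (FLess t u)
  then show ?case
    using acost_compile_tm[of t] acost_compile_tm[of u]
    by (auto simp: aval_compile_tm intro!: terminates_mono[OF terminates_set_result[OF refl]])
next
  case (FSame i j)
  then show ?case
    by (auto simp: aval_index index_def[of i] index_def[of j] represents_def
        intro!: terminates_mono[OF terminates_set_result[OF refl]])
next
  case (FNot f)
  have "terminates (compile_fm (FNot f)) s (1 + poly (fm_cost f) n + 20)
      (\<lambda>s'. formula_frame X s s' \<and> s' ''res'' 0 = of_bool (fval n (FNot f) \<rho> M))"
    unfolding compile_fm.simps
  proof (rule terminates_Seq[OF FNot.IH[OF FNot.prems(1)]])
    fix s' assume s': "formula_frame X s s' \<and> s' ''res'' 0 = of_bool (fval n f \<rho> M)"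
    show "terminates (set_result (Neg result_true)) s' 20
      (\<lambda>s'. formula_frame X s s' \<and> s' ''res'' 0 = of_bool (fval n (FNot f) \<rho> M))"
      using s' by (intro terminates_mono[OF terminates_set_result[OF refl]])
        (auto simp: result_true_def intro: formula_frame_trans)
  qed (use FNot.prems in simp)
  then show ?case by (rule terminates_mono) simp_all
next
  case (FAnd f g)
  have "terminates (compile_fm (FAnd f g)) s
      (1 + poly (fm_cost f) n + (1 + bcost result_true + poly (fm_cost g) n + 1))
      (\<lambda>s'. formula_frame X s s' \<and> s' ''res'' 0 = of_bool (fval n (FAnd f g) \<rho> M))"
    unfolding compile_fm.simps
  proof (rule terminates_Seq[OF FAnd.IH(1)[OF FAnd.prems(1)]], goal_cases)
    case (2 s')
    show ?case
    proof (rule terminates_Cond)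
      assume "bval result_true s'"
      with 2 have f: "fval n f \<rho> M" by (auto simp: result_true_def)
      have "represents n X \<rho> M s'" using FAnd.prems 2 represents_formula_frame by blast
      from FAnd.IH(2)[OF this] FAnd.prems
      show "terminates (compile_fm g) s' (poly (fm_cost g) n)
        (\<lambda>s'. formula_frame X s s' \<and> s' ''res'' 0 = of_bool (fval n (FAnd f g) \<rho> M))"
        using f 2 by (auto elim!: terminates_mono intro: formula_frame_trans)
    qed (rule terminates_Skip, use 2 in \<open>auto simp: result_true_def\<close>)
  qed (use FAnd.prems in simp)
  then show ?case by (rule terminates_mono) (simp_all add: result_true_def)
next
  case (FEx i f)
  \<comment> \<open>The accumulator records whether a witness below the counter has been found.
    Since i is not in X, neither counter nor accumulator of i is protected by the frame.\<close>
  define I where "I = (\<lambda>j s'. formula_frame X s s' \<and> s' ''i'' (int i) = int j \<and>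
    s' ''acc'' (int i) = of_bool (\<exists>k<j. fval n f (\<rho>(i := k)) M))"
  from FEx.prems have iX: "i \<notin> X" and wf: "fwf (insert i X) f" by auto
  have body: "terminates (Seq (compile_fm f)
      (Cond result_true (Put ''acc'' (Const (int i)) (Const 1)) Skip)) s'
      (1 + poly (fm_cost f) n + 10)
      (\<lambda>s'. s' ''i'' (int i) = int j \<and> I (Suc j) (set_index i (Suc j) s'))"
    if j: "j < n" and I: "I j s'" for j s'
  proof -
    have "represents n (insert i X) (\<rho>(i := j)) M s'"
      using I j FEx.prems(1) iX by (auto simp: represents_def I_def formula_frame_def)
    note IH = FEx.IH[OF this wf]
    show ?thesis
    proof (rule terminates_Seq[OF IH])
      fix s'' assume s'': "formula_frame (insert i X) s' s'' \<and>
        s'' ''res'' 0 = of_bool (fval n f (\<rho>(i := j)) M)"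
      have less: "(\<exists>k<Suc j. P k) \<longleftrightarrow> (\<exists>k<j. P k) \<or> P j" for P
        using less_Suc_eq by auto
      show "terminates (Cond result_true (Put ''acc'' (Const (int i)) (Const 1)) Skip) s'' 10
          (\<lambda>s'. s' ''i'' (int i) = int j \<and> I (Suc j) (set_index i (Suc j) s'))"
        using s'' I iX
        by (intro terminates_mono[OF terminates_Cond[OF terminates_Put terminates_Skip]])
          (auto simp: result_true_def I_def less formula_frame_def of_bool_def split: if_splits)
    qed
  qed
  have "terminates (compile_fm (FEx i f)) s
      (1 + 3 + (1 + (10 + n * (1 + poly (fm_cost f) n + 10 + 13)) + 15))
      (\<lambda>s'. formula_frame X s s' \<and> s' ''res'' 0 = of_bool (fval n (FEx i f) \<rho> M))"
    unfolding compile_fm.simps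
  proof (rule terminates_Seq[where R = "\<lambda>s'. I 0 (set_index i 0 s')"])
    show "terminates (Put ''acc'' (Const (int i)) (Const 0)) s 3 (\<lambda>s'. I 0 (set_index i 0 s'))"
      using iX by (intro terminates_mono[OF terminates_Put]) (auto simp: I_def formula_frame_def)
  next
    fix s1 assume s1: "I 0 (set_index i 0 s1)"
    show "terminates (Seq (for_loop i (Seq (compile_fm f)
        (Cond result_true (Put ''acc'' (Const (int i)) (Const 1)) Skip)))
      (set_result (Less (Const 0) (Get ''acc'' (Const (int i)))))) s1
      (1 + (10 + n * (1 + poly (fm_cost f) n + 10 + 13)) + 15)
      (\<lambda>s'. formula_frame X s s' \<and> s' ''res'' 0 = of_bool (fval n (FEx i f) \<rho> M))"
    proof (rule terminates_Seq[where R = "I n"])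
      show "terminates (for_loop i (Seq (compile_fm f)
          (Cond result_true (Put ''acc'' (Const (int i)) (Const 1)) Skip))) s1
          (10 + n * (1 + poly (fm_cost f) n + 10 + 13)) (I n)"
        by (rule terminates_for_loop)
          (use s1 body FEx.prems(1) in \<open>auto simp: I_def formula_frame_def represents_def\<close>)
    next
      fix s2 assume "I n s2"
      then show "terminates (set_result (Less (Const 0) (Get ''acc'' (Const (int i))))) s2 15
        (\<lambda>s'. formula_frame X s s' \<and> s' ''res'' 0 = of_bool (fval n (FEx i f) \<rho> M))"
        by (intro terminates_mono[OF terminates_set_result[OF refl]])
          (auto simp: I_def intro: formula_frame_trans)
    qed
  qed
  then show ?case
    by (rule terminates_mono) (simp_all add: algebra_simps)
qed

lemma represents_insert:
  assumes "represents n X \<rho> M s" "j < n" "s ''i'' (int i) = int j"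
  shows "represents n (insert i X) (\<rho>(i := j)) M s"
  using assms by (auto simp: represents_def)

lemma represents_set_index:
  assumes "represents n X \<rho> M s" "i \<notin> X"
  shows "represents n X \<rho> M (set_index i l s)"
  using assms by (auto simp: represents_def)

lemma represents_put:
  assumes "represents n X \<rho> M s" "i < n" "j < n"
  shows "represents n X \<rho> (M(a := (M a)(i := (M a i)(j := z))))
    (s(mat_name a := (s (mat_name a))(int (i * n + j) := z)))"
  using assms by (auto simp: represents_def position_inj simp del: of_nat_add of_nat_mult)

lemma represents_remove:
  assumes "represents n (insert i X) (\<rho>(i := j)) M s" "i \<notin> X"
  shows "represents n X \<rho> M s" and "s ''i'' (int i) = int j"
proof -
  have "(\<rho>(i := j)) k = \<rho> k" if "k \<in> X" for k using that assms(2) by auto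
  then show "represents n X \<rho> M s" using assms(1) unfolding represents_def by simp
  show "s ''i'' (int i) = int j" using assms(1) by (simp add: represents_def)
qed

lemma prog_frame_set_index: "prog_frame s s' \<Longrightarrow> prog_frame s (set_index i l s')"
  by (simp add: prog_frame_def)

text \<open>The budget depends on n alone, never on the contents of the memory: a loop costs n times
  the polynomial of its body plus overhead. This settles the running time of everything between
  loading the input and storing the output.\<close>

lemma terminates_compile:
  "represents n X \<rho> M s \<Longrightarrow> pwf X p \<Longrightarrow>
    terminates (compile p) s (poly (prog_cost p) n)
      (\<lambda>s'. represents n X \<rho> (psem n p \<rho> M) s' \<and> prog_frame s s')"
proof (induction p arbitrary: X \<rho> M s)
  case PSkip
  then show ?case
    unfolding compile.simps psem.simps
    by (intro terminates_mono[OF terminates_Skip[where Q = "\<lambda>s'. represents n X \<rho> M s' \<and> prog_frame s s'"]])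
      (simp_all add: prog_frame_refl)
next
  case (PSet a i j t)
  then have wf: "i \<in> X" "j \<in> X" "twf X t" by auto
  note rep = PSet.prems(1)
  have lt: "\<rho> i < n" "\<rho> j < n" using rep wf by (auto simp: represents_def)
  let ?s = "s(mat_name a := (s (mat_name a))(int (\<rho> i * n + \<rho> j) := tval t \<rho> M))"
  have "represents n X \<rho> (psem n (PSet a i j t) \<rho> M) ?s"
    using represents_put[OF rep lt] by simp
  moreover have "prog_frame s ?s" by (simp add: prog_frame_def)
  ultimately have "terminates (compile (PSet a i j t)) s
     (1 + acost (position (index i) (index j)) + acost (compile_tm t))
     (\<lambda>s'. represents n X \<rho> (psem n (PSet a i j t) \<rho> M) s' \<and> prog_frame s s')"
    unfolding compile.simps
    by (intro terminates_Put) (simp only: aval_position[OF rep wf(1,2)] aval_compile_tm[OF rep wf(3)])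
  then show ?case
  proof (rule terminates_mono)
    show "1 + acost (position (index i) (index j)) + acost (compile_tm t) \<le> poly (prog_cost (PSet a i j t)) n"
      using acost_compile_tm[of t] by (simp add: index_def position_def)
  qed
next
  case (PSeq p q)
  have "terminates (compile (PSeq p q)) s (1 + poly (prog_cost p) n + poly (prog_cost q) n)
     (\<lambda>s'. represents n X \<rho> (psem n (PSeq p q) \<rho> M) s' \<and> prog_frame s s')"
    unfolding compile.simps
  proof (rule terminates_Seq[OF PSeq.IH(1)[OF PSeq.prems(1)]], goal_cases)
    case (2 s')
    with PSeq.IH(2)[of X \<rho> "psem n p \<rho> M" s'] PSeq.prems show ?case
      by (auto elim!: terminates_mono intro: prog_frame_trans)
  qed (use PSeq.prems in simp)
  then show ?case by (rule terminates_mono) simp_all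
next
  case (PIf f p q)
  then have wf: "fwf X f" "pwf X p" "pwf X q" by auto
  have "terminates (compile (PIf f p q)) s
     (1 + poly (fm_cost f) n + (1 + bcost result_true + poly (prog_cost p) n + poly (prog_cost q) n))
     (\<lambda>s'. represents n X \<rho> (psem n (PIf f p q) \<rho> M) s' \<and> prog_frame s s')"
    unfolding compile.simps
  proof (rule terminates_Seq[OF terminates_compile_fm[OF PIf.prems(1) wf(1)]], goal_cases)
    case (1 s')
    then have rep: "represents n X \<rho> M s'" and fr: "prog_frame s s'"
      using PIf.prems represents_formula_frame formula_frame_prog_frame by blast+
    have res: "bval result_true s' = fval n f \<rho> M" using 1 by (simp add: result_true_def)
    show ?case
      by (rule terminates_Cond)
        (use PIf.IH(1)[OF rep wf(2)] PIf.IH(2)[OF rep wf(3)] fr res in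
          \<open>auto elim!: terminates_mono intro: prog_frame_trans\<close>)
  qed
  then show ?case by (rule terminates_mono) (simp_all add: result_true_def)
next
  case (PFor i p)
  define step where "step = (\<lambda>k. psem n p (\<rho>(i := k)))"
  define I where "I = (\<lambda>j s'. represents n X \<rho> (fold step [0..<j] M) s' \<and>
    s' ''i'' (int i) = int j \<and> prog_frame s s')"
  from PFor.prems have iX: "i \<notin> X" and wf: "pwf (insert i X) p" by auto
  have "terminates (compile (PFor i p)) s (10 + n * (poly (prog_cost p) n + 13)) (I n)"
    unfolding compile.simps
  proof (rule terminates_for_loop)
    show "I 0 (set_index i 0 s)"
      using PFor.prems(1) iX
      by (simp add: I_def represents_set_index prog_frame_set_index prog_frame_refl)
  next
    fix j s' assume j: "j < n" and I: "I j s'"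
    have rep: "represents n (insert i X) (\<rho>(i := j)) (fold step [0..<j] M) s'"
      using I j by (intro represents_insert) (auto simp: I_def)
    from PFor.IH[OF rep wf] show "terminates (compile p) s' (poly (prog_cost p) n)
        (\<lambda>s'. s' ''i'' (int i) = int j \<and> I (Suc j) (set_index i (Suc j) s'))"
    proof (rule terminates_mono, goal_cases)
      case (2 s'')
      then have "represents n (insert i X) (\<rho>(i := j)) (fold step [0..<Suc j] M) s''"
        by (simp add: step_def fun_upd_def)
      with 2 iX I show ?case
        by (auto simp: I_def intro: represents_set_index represents_remove prog_frame_set_index
            prog_frame_trans)
    qed simp
  qed (simp_all add: I_def represents_def)
  then show ?case
    by (rule terminates_mono) (simp_all add: I_def step_def algebra_simps)
qed


section \<open>Loops over all cells, and formulas unaffected by them\<close>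

lemma fold_upt_induct:
  assumes "P 0 M" and "\<And>l M. l < n \<Longrightarrow> P l M \<Longrightarrow> P (Suc l) (f l M)"
  shows "P n (fold f [0..<n] M)"
  using assms(2)
proof (induction n)
  case (Suc n)
  then show ?case by simp
qed (simp add: assms(1))

fun tm_mats :: "tm \<Rightarrow> mat set" where
  "tm_mats (Num z) = {}"
| "tm_mats (Cell a i j) = {a}"

fun fm_mats :: "fm \<Rightarrow> mat set" where
  "fm_mats (FLess t u) = tm_mats t \<union> tm_mats u"
| "fm_mats (FSame i j) = {}"
| "fm_mats (FNot f) = fm_mats f"
| "fm_mats (FAnd f g) = fm_mats f \<union> fm_mats g"
| "fm_mats (FEx i f) = fm_mats f"

lemma tval_cong:
  "twf X t \<Longrightarrow> (\<And>k. k \<in> X \<Longrightarrow> \<rho> k = \<rho>' k) \<Longrightarrow> (\<And>a. a \<in> tm_mats t \<Longrightarrow> M a = M' a) \<Longrightarrow>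
    tval t \<rho> M = tval t \<rho>' M'"
  by (cases t) auto

text \<open>Lets a formula keep its value while loops alter counters and matrices on which it does
  not depend.\<close>

lemma fval_cong:
  "fwf X f \<Longrightarrow> (\<And>k. k \<in> X \<Longrightarrow> \<rho> k = \<rho>' k) \<Longrightarrow> (\<And>a. a \<in> fm_mats f \<Longrightarrow> M a = M' a) \<Longrightarrow>
    fval n f \<rho> M = fval n f \<rho>' M'"
proof (induction f arbitrary: X \<rho> \<rho>')
  case (FLess t u)
  have "tval t \<rho> M = tval t \<rho>' M'" "tval u \<rho> M = tval u \<rho>' M'"
    by (rule tval_cong[of X]; use FLess in auto)+
  then show ?case by simp
next
  case (FNot f)
  from FNot.IH[of X \<rho> \<rho>'] FNot.prems show ?case by simp
next
  case (FAnd f g)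
  from FAnd.IH(1)[of X \<rho> \<rho>'] FAnd.IH(2)[of X \<rho> \<rho>'] FAnd.prems show ?case by simp
next
  case (FEx i f)
  have "fval n f (\<rho>(i := k)) M = fval n f (\<rho>'(i := k)) M'" for k
    by (rule FEx.IH[of "insert i X"]) (use FEx.prems in auto)
  then show ?case by simp
qed auto

text \<open>A double loop visits each cell once, so the entry about to be computed still has its
  original value, and this is all that \<open>step\<close> may assume about the matrix a. The set B
  collects scratch matrices, whose contents are not tracked.\<close>

lemma psem_cells:
  fixes B :: "mat set"
  assumes step: "\<And>k l M'. k < n \<Longrightarrow> l < n \<Longrightarrow> (\<And>b. b \<notin> insert a B \<Longrightarrow> M' b = M b) \<Longrightarrow>
      M' a k l = M a k l \<Longrightarrow>
      (\<forall>b. b \<notin> insert a B \<longrightarrow> psem n p (\<rho>(i := k, j := l)) M' b = M b) \<and>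
      psem n p (\<rho>(i := k, j := l)) M' a = (M' a)(k := (M' a k)(l := g k l))"
  shows "b \<notin> insert a B \<Longrightarrow> psem n (PFor i (PFor j p)) \<rho> M b = M b"
    and "psem n (PFor i (PFor j p)) \<rho> M a = (\<lambda>k l. if k < n \<and> l < n then g k l else M a k l)"
proof -
  \<comment> \<open>S is the set of cells already visited.\<close>
  define R where "R = (\<lambda>S M'. (\<forall>b. b \<notin> insert a B \<longrightarrow> M' b = M b) \<and>
    M' a = (\<lambda>k l. if (k, l) \<in> S then g k l else M a k l))"
  have cell: "R (insert (k, l) S) (psem n p (\<rho>(i := k, j := l)) M')"
    if "k < n" "l < n" "(k, l) \<notin> S" "R S M'" for k l S M'
    using step[OF that(1,2), of M'] that(3,4) by (auto simp: R_def fun_eq_iff)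
  have row: "R ({..<k} \<times> {..<n} \<union> {k} \<times> {..<n}) (psem n (PFor j p) (\<rho>(i := k)) M')"
    if "k < n" "R ({..<k} \<times> {..<n}) M'" for k M'
    unfolding psem.simps
  proof (rule fold_upt_induct[where P = "\<lambda>l. R ({..<k} \<times> {..<n} \<union> {k} \<times> {..<l})"])
    fix l M' assume l: "l < n" and R: "R ({..<k} \<times> {..<n} \<union> {k} \<times> {..<l}) M'"
    have "insert (k, l) ({..<k} \<times> {..<n} \<union> {k} \<times> {..<l}) = {..<k} \<times> {..<n} \<union> {k} \<times> {..<Suc l}"
      by auto
    with cell[OF that(1) l _ R]
    show "R ({..<k} \<times> {..<n} \<union> {k} \<times> {..<Suc l}) (psem n p (\<rho>(i := k, j := l)) M')" by auto
  qed (use that in simp)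
  have "R ({..<n} \<times> {..<n}) (psem n (PFor i (PFor j p)) \<rho> M)"
    unfolding psem.simps(5)[of n i]
  proof (rule fold_upt_induct[where P = "\<lambda>k. R ({..<k} \<times> {..<n})"])
    fix k M' assume k: "k < n" and R: "R ({..<k} \<times> {..<n}) M'"
    have "{..<k} \<times> {..<n} \<union> {k} \<times> {..<n} = {..<Suc k} \<times> {..<n}" by auto
    with row[OF k R] show "R ({..<Suc k} \<times> {..<n}) (psem n (PFor j p) (\<rho>(i := k)) M')" by simp
  qed (simp add: R_def)
  then show "b \<notin> insert a B \<Longrightarrow> psem n (PFor i (PFor j p)) \<rho> M b = M b"
    and "psem n (PFor i (PFor j p)) \<rho> M a = (\<lambda>k l. if k < n \<and> l < n then g k l else M a k l)"
    by (auto simp: R_def)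
qed


section \<open>Reachability\<close>

text \<open>
  In \<open>reach a g\<close> the formula \<open>g\<close> describes an edge from variable 14 to variable 11. A graph on
  \<open>n\<close> vertices has at most \<open>n\<^sup>2\<close> edges, so \<open>n\<^sup>2\<close> rounds of propagation suffice.
\<close>

definition reach :: "mat \<Rightarrow> fm \<Rightarrow> prog" where
  "reach a g = PSeq
     (PFor 10 (PFor 11 (PIf (FSame 10 11) (PSet a 10 11 (Num 1)) (PSet a 10 11 (Num 0)))))
     (PFor 12 (PFor 13 (PFor 10 (PFor 11 (PFor 14
       (PIf (FAnd (FLess (Num 0) (Cell a 10 14)) g) (PSet a 10 11 (Num 1)) PSkip))))))"

text \<open>S collects what has been established and grows by \<open>h k\<close> in round k. The
  fixed part S0, known before the loop starts, is what the body may rely on in every round.\<close>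

lemma fold_grow:
  assumes "\<And>k S M. k \<in> set xs \<Longrightarrow> S0 \<subseteq> S \<Longrightarrow> P S M \<Longrightarrow> P (S \<union> h k) (f k M)"
    and "S0 \<subseteq> S" "P S M"
  shows "P (S \<union> (\<Union>k\<in>set xs. h k)) (fold f xs M)"
  using assms
proof (induction xs arbitrary: S M)
  case (Cons x xs)
  have "P (S \<union> h x \<union> (\<Union>k\<in>set xs. h k)) (fold f xs (f x M))"
    by (rule Cons.IH) (use Cons.prems in auto)
  then show ?case by (simp add: Un_assoc)
qed simp

lemma rtrancl_eq_relpow_bounded:
  fixes E :: "(nat \<times> nat) set"
  assumes "E \<subseteq> {..<n} \<times> {..<n}"
  shows "E\<^sup>* = (\<Union>l\<in>{..n * n}. E ^^ l)"
proof -
  have fin: "finite E" using assms finite_subset by blast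
  have "card E \<le> n * n" using card_mono[OF _ assms] by simp
  then show ?thesis
    using rtrancl_finite_eq_relpow[OF fin] by (auto simp: rtrancl_power intro: order_trans)
qed

text \<open>The matrix a is updated in place, so an entry may become 1 earlier than its path length
  suggests. The proof therefore does not describe the matrix after each round exactly but bounds it
  from both sides: every 1 is justified by reachability, and certain entries are guaranteed to be
  1.\<close>

lemma psem_reach:
  fixes n g \<rho> M
  defines "E \<equiv> {(k, l). k < n \<and> l < n \<and> fval n g (\<rho>(14 := k, 11 := l)) M}"
  assumes wf: "fwf X g" "X \<inter> {10, 12, 13} = {}" and a: "a \<notin> fm_mats g"
  shows "b \<noteq> a \<Longrightarrow> psem n (reach a g) \<rho> M b = M b"
    and "psem n (reach a g) \<rho> M a =
      (\<lambda>i j. if i < n \<and> j < n then of_bool ((i, j) \<in> E\<^sup>*) else M a i j)"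
proof -
  define N where "N = {..<n} \<times> {..<n}"
  \<comment> \<open>Soundness for all entries, completeness for the pairs in S. Applied to S equal
    to the whole closure, the two determine the matrix.\<close>
  define R where "R = (\<lambda>S M'. (\<forall>b. b \<noteq> a \<longrightarrow> M' b = M b) \<and>
    (\<forall>i j. if (i, j) \<in> N then (M' a i j = 0 \<or> M' a i j = 1) \<and> (0 < M' a i j \<longrightarrow> (i, j) \<in> E\<^sup>*)
      else M' a i j = M a i j) \<and> (\<forall>(i, j)\<in>S. (i, j) \<in> N \<longrightarrow> 0 < M' a i j))"
  define init where
    "init = PFor 10 (PFor 11 (PIf (FSame 10 11) (PSet a 10 11 (Num 1)) (PSet a 10 11 (Num 0))))"
  define body where
    "body = PIf (FAnd (FLess (Num 0) (Cell a 10 14)) g) (PSet a 10 11 (Num 1)) PSkip"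
  define round where "round = PFor 10 (PFor 11 (PFor 14 body))"
  define step where "step = (\<lambda>S :: (nat \<times> nat) set. {(i, j). \<exists>k. (i, k) \<in> S \<and> (k, j) \<in> E})"
  have R_mono: "R S M' \<Longrightarrow> T \<subseteq> S \<Longrightarrow> R T M'" for S T M'
    unfolding R_def by (elim conjE, intro conjI) blast+
  have init: "R Id (psem n init \<rho> M)"
    using psem_cells[where a = a and B = "{}" and n = n and i = 10 and j = 11 and
        p = "PIf (FSame 10 11) (PSet a 10 11 (Num 1)) (PSet a 10 11 (Num 0))" and \<rho> = \<rho> and M = M
        and g = "\<lambda>k l. if k = l then 1 else 0"]
    by (auto simp: R_def init_def N_def fun_eq_iff simp del: psem.simps(5))
  have body: "R (S \<union> (if (i, k) \<in> S0 \<and> (k, j) \<in> E then {(i, j)} else {}))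
      (psem n body (\<rho>(12 := l, 13 := l', 10 := i, 11 := j, 14 := k)) M')"
    if lt: "i < n" "j < n" "k < n" and S0: "S0 \<subseteq> S" and R: "R S M'" for i j k l l' S S0 M'
  proof -
    \<comment> \<open>Although evaluated under altered counters and matrices, g keeps the value
      fixed in \<open>E\<close>: none of 10, 12, 13 is free in it and it does not read a.\<close>
    have "fval n g (\<rho>(12 := l, 13 := l', 10 := i, 11 := j, 14 := k)) M' \<longleftrightarrow>
        fval n g (\<rho>(14 := k, 11 := j)) M"
      by (rule fval_cong[OF wf(1)]) (use wf(2) a R in \<open>auto simp: R_def\<close>)
    then have g: "fval n g (\<rho>(12 := l, 13 := l', 10 := i, 11 := j, 14 := k)) M' \<longleftrightarrow> (k, j) \<in> E"
      using lt by (simp add: E_def)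
    have "(i, k) \<in> E\<^sup>*" if "0 < M' a i k"
    proof -
      have "(i, k) \<in> N" using lt by (simp add: N_def)
      with that R show ?thesis unfolding R_def by presburger
    qed
    then have E: "(i, j) \<in> E\<^sup>*" if "0 < M' a i k" "(k, j) \<in> E"
      using that by (meson rtrancl.rtrancl_into_rtrancl)
    have S: "0 < M' a i k" if "(i, k) \<in> S0"
    proof -
      have "(i, k) \<in> N" using lt by (simp add: N_def)
      with that S0 R show ?thesis unfolding R_def by blast
    qed
    have N: "(i, j) \<in> N" using lt by (simp add: N_def)
    show ?thesis
    proof (cases "0 < M' a i k \<and> (k, j) \<in> E")
      case True
      then have "psem n body (\<rho>(12 := l, 13 := l', 10 := i, 11 := j, 14 := k)) M' =
          M'(a := (M' a)(i := (M' a i)(j := 1)))"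
        by (simp add: body_def g)
      then show ?thesis using R E True N by (auto simp: R_def)
    next
      case False
      then have "psem n body (\<rho>(12 := l, 13 := l', 10 := i, 11 := j, 14 := k)) M' = M'"
        by (auto simp: body_def g)
      then show ?thesis using R S False by auto
    qed
  qed
  have round: "R (S \<union> step S) (psem n round (\<rho>(12 := l, 13 := l')) M')" if "R S M'" for S M' l l'
  proof -
    let ?\<rho> = "\<rho>(12 := l, 13 := l')"
    \<comment> \<open>The loops over 14, 11 and 10 are treated from the inside out. S stays frozen
      as the set known at the start of the round; T is what has accumulated since.\<close>
    have 1: "R (T \<union> (\<Union>k\<in>set [0..<n]. if (i, k) \<in> S \<and> (k, j) \<in> E then {(i, j)} else {}))
        (psem n (PFor 14 body) (?\<rho>(10 := i, 11 := j)) M')"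
      if "i < n" "j < n" "S \<subseteq> T" "R T M'" for i j T M'
      unfolding psem.simps
      by (rule fold_grow[where P = R and ?S0.0 = S]) (use that in \<open>simp_all only: set_upt atLeastLessThan_iff body\<close>)
    have 2: "R (T \<union> (\<Union>j\<in>set [0..<n]. \<Union>k\<in>set [0..<n]. if (i, k) \<in> S \<and> (k, j) \<in> E then {(i, j)} else {}))
        (psem n (PFor 11 (PFor 14 body)) (?\<rho>(10 := i)) M')"
      if "i < n" "S \<subseteq> T" "R T M'" for i T M'
      unfolding psem.simps(5)[of n 11]
      by (rule fold_grow[where P = R and ?S0.0 = S])
        (use that 1 in \<open>simp_all only: atLeastLessThan_iff atLeast_upt[symmetric] lessThan_iff\<close>)
    have 3: "R (S \<union> (\<Union>i\<in>set [0..<n]. \<Union>j\<in>set [0..<n]. \<Union>k\<in>set [0..<n].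
          if (i, k) \<in> S \<and> (k, j) \<in> E then {(i, j)} else {}))
        (psem n round ?\<rho> M')"
      unfolding round_def psem.simps(5)[of n 10]
      by (rule fold_grow[where P = R and ?S0.0 = S])
        (use \<open>R S M'\<close> 2 in \<open>simp_all only: atLeastLessThan_iff atLeast_upt[symmetric] lessThan_iff subset_refl\<close>)
    have "0 < psem n round ?\<rho> M' a i j" if "(i, j) \<in> S \<union> step S" "(i, j) \<in> N" for i j
    proof -
      from that have "(i, j) \<in> S \<union> (\<Union>i\<in>set [0..<n]. \<Union>j\<in>set [0..<n]. \<Union>k\<in>set [0..<n].
          if (i, k) \<in> S \<and> (k, j) \<in> E then {(i, j)} else {})"
        by (auto simp: step_def N_def E_def)
      with 3 that(2) show ?thesis unfolding R_def by blast
    qed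
    with 3 show ?thesis unfolding R_def by blast
  qed
  \<comment> \<open>After l rounds all pairs joined by a walk of at most l edges are certain. The
    nested counters 12 and 13 together count to n * n.\<close>
  define Q where "Q = (\<lambda>l. R (\<Union>l'\<in>{..l}. E ^^ l'))"
  have Q_round: "Q (Suc l) (psem n round (\<rho>(12 := k, 13 := k')) M')" if "Q l M'" for l k k' M'
  proof -
    have "(\<Union>l'\<in>{..Suc l}. E ^^ l') \<subseteq> (\<Union>l'\<in>{..l}. E ^^ l') \<union> step (\<Union>l'\<in>{..l}. E ^^ l')"
      by (auto simp: step_def le_Suc_eq) (meson atMost_iff order_refl)
    with round[OF that[unfolded Q_def]] show ?thesis unfolding Q_def by (rule R_mono)
  qed
  have Q_rounds: "Q (l * n + n) (psem n (PFor 13 round) (\<rho>(12 := k)) M')" if "Q (l * n) M'" for l k M'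
    unfolding psem.simps
    by (rule fold_upt_induct[where P = "\<lambda>k'. Q (l * n + k')"]) (use that Q_round in auto)
  have "Q (n * n) (psem n (PFor 12 (PFor 13 round)) \<rho> (psem n init \<rho> M))"
    unfolding psem.simps(5)[of n 12]
    by (rule fold_upt_induct[where P = "\<lambda>k. Q (k * n)"])
      (use init Q_rounds in \<open>auto simp: Q_def add.commute\<close>)
  moreover have "E \<subseteq> {..<n} \<times> {..<n}" by (auto simp: E_def)
  ultimately have R: "R (E\<^sup>*) (psem n (reach a g) \<rho> M)"
    by (simp only: Q_def rtrancl_eq_relpow_bounded reach_def init_def round_def body_def psem.simps(3))
  then show "b \<noteq> a \<Longrightarrow> psem n (reach a g) \<rho> M b = M b"
    by (simp add: R_def)
  show "psem n (reach a g) \<rho> M a =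
      (\<lambda>i j. if i < n \<and> j < n then of_bool ((i, j) \<in> E\<^sup>*) else M a i j)"
  proof (intro ext)
    fix i j
    let ?r = "psem n (reach a g) \<rho> M a i j"
    from R have "if (i, j) \<in> N then (?r = 0 \<or> ?r = 1) \<and> (0 < ?r \<longrightarrow> (i, j) \<in> E\<^sup>*) else ?r = M a i j"
      and "(i, j) \<in> E\<^sup>* \<longrightarrow> (i, j) \<in> N \<longrightarrow> 0 < ?r"
      unfolding R_def by blast+
    then show "?r = (if i < n \<and> j < n then of_bool ((i, j) \<in> E\<^sup>*) else M a i j)"
      by (auto simp: N_def split: if_splits)
  qed
qed

section \<open>Paths as reachability\<close>

lemma path_edges_simps [simp]:
  "path_edges [] = {}" "path_edges [u] = {}"
  "path_edges (u # w # p) = insert (u, w) (path_edges (w # p))"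
  by (simp_all add: path_edges_def)

lemma path_edges_snoc: "p \<noteq> [] \<Longrightarrow> path_edges (p @ [w]) = insert (last p, w) (path_edges p)"
proof (induction p)
  case (Cons u p)
  then show ?case by (cases p) auto
qed simp

lemma path_edges_prefix: "path_edges p \<subseteq> path_edges (p @ q)"
proof (induction p)
  case (Cons u p)
  then show ?case by (cases p) auto
qed simp

lemma finite_path_edges: "finite (path_edges p)"
  by (simp add: path_edges_def)

text \<open>Simplicity of paths costs nothing: if the next vertex of a walk already lies on the
  simple path built so far, that path is cut there, and its edges remain admissible. The one-vertex
  path corresponds to reflexivity.\<close>

lemma ex_path_iff_rtrancl:
  "(\<exists>p. is_path F u p w \<and> (\<forall>e\<in>path_edges p. Q e)) \<longleftrightarrow> (u, w) \<in> {e \<in> dom F. Q e}\<^sup>*"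
proof
  assume "\<exists>p. is_path F u p w \<and> (\<forall>e\<in>path_edges p. Q e)"
  then obtain p where "is_path F u p w" "\<forall>e\<in>path_edges p. Q e" by blast
  then show "(u, w) \<in> {e \<in> dom F. Q e}\<^sup>*"
  proof (induction p arbitrary: u)
    case (Cons a p)
    show ?case
    proof (cases p)
      case Nil
      with Cons.prems show ?thesis by (auto simp: is_path_def)
    next
      case (Cons b q)
      with Cons.prems have "(u, b) \<in> {e \<in> dom F. Q e}" and "is_path F b p w"
        and "\<forall>e\<in>path_edges p. Q e"
        by (auto simp: is_path_def)
      with Cons.IH show ?thesis by (meson converse_rtrancl_into_rtrancl)
    qed
  qed (simp add: is_path_def)
next
  assume "(u, w) \<in> {e \<in> dom F. Q e}\<^sup>*"
  then show "\<exists>p. is_path F u p w \<and> (\<forall>e\<in>path_edges p. Q e)"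
  proof (induction rule: rtrancl_induct)
    case base
    then show ?case by (intro exI[of _ "[u]"]) (simp add: is_path_def)
  next
    case (step x z)
    then obtain p where p: "is_path F u p x" "\<forall>e\<in>path_edges p. Q e" by blast
    show ?case
    proof (cases "z \<in> set p")
      case False
      with p step.hyps(2) show ?thesis
        by (intro exI[of _ "p @ [z]"]) (auto simp: is_path_def path_edges_snoc)
    next
      case True
      then obtain q r where "p = q @ z # r" by (meson split_list)
      with p path_edges_prefix[of "q @ [z]" r] show ?thesis
        by (intro exI[of _ "q @ [z]"]) (auto simp: is_path_def hd_append split: if_splits)
    qed
  qed
qed

lemma set_eq_path_vertices: "p \<noteq> [] \<Longrightarrow> set p = insert (hd p) (snd ` path_edges p)"
proof (induction p)
  case (Cons u p)
  then show ?case by (cases p) auto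
qed simp

lemma fst_path_edges: "e \<in> path_edges p \<Longrightarrow> fst e \<in> set p"
  unfolding path_edges_def by (metis prod.collapse set_zip_leftD)

text \<open>Avoiding y is again a condition on single edges, except that the start needs its own
  clause because the one-vertex path has no edges.\<close>

lemma ex_avoiding_path_iff_rtrancl:
  "(\<exists>p. is_path F u p w \<and> (\<forall>e\<in>path_edges p. Q e) \<and> y \<notin> set p) \<longleftrightarrow>
    u \<noteq> y \<and> (u, w) \<in> {e \<in> dom F. Q e \<and> fst e \<noteq> y \<and> snd e \<noteq> y}\<^sup>*"
proof -
  have "y \<notin> set p \<longleftrightarrow> u \<noteq> y \<and> (\<forall>e\<in>path_edges p. fst e \<noteq> y \<and> snd e \<noteq> y)"
    if "is_path F u p w" for p
    using that set_eq_path_vertices[of p] fst_path_edges[of _ p]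
    by (auto simp: is_path_def)
  then have "(\<exists>p. is_path F u p w \<and> (\<forall>e\<in>path_edges p. Q e) \<and> y \<notin> set p) \<longleftrightarrow>
    u \<noteq> y \<and> (\<exists>p. is_path F u p w \<and> (\<forall>e\<in>path_edges p. Q e \<and> fst e \<noteq> y \<and> snd e \<noteq> y))"
    by blast
  then show ?thesis by (simp only: ex_path_iff_rtrancl)
qed

text \<open>Inserting \<infinity> into the minimum makes the bound vacuous for the one-vertex path,
  in agreement with the empty conjunction on the right.\<close>

lemma strength_greater_iff:
  "strength m p > ereal (real_of_int k) \<longleftrightarrow> (\<forall>e\<in>path_edges p. m e > k)"
  unfolding strength_def using finite_path_edges[of p] by (subst Min_gr_iff) auto

lemma strength_ge_iff:
  "strength m p \<ge> ereal (real_of_int k) \<longleftrightarrow> (\<forall>e\<in>path_edges p. m e \<ge> k)"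
  unfolding strength_def using finite_path_edges[of p] by (subst Min_ge_iff) auto

definition strong_edges :: "('a \<times> 'a \<Rightarrow> int) \<Rightarrow> 'a diagram \<Rightarrow> int \<Rightarrow> ('a \<times> 'a) set" where
  "strong_edges m F k = {e \<in> dom F. m e > k}"

text \<open>An edge leaving y is never bad, since returning to y would take an edge with head
  y.\<close>

definition bad_edge :: "('a \<times> 'a \<Rightarrow> int) \<Rightarrow> 'a diagram \<Rightarrow> 'a \<Rightarrow> 'a \<times> 'a \<Rightarrow> bool" where
  "bad_edge m F y = (\<lambda>(c, d). F (c, d) = Some CC \<and> d \<noteq> y \<and>
     (d, c) \<in> {e \<in> dom F. m e \<ge> m (c, d) \<and> fst e \<noteq> y \<and> snd e \<noteq> y}\<^sup>*)"

lemma reject_cycle_iff: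
  "reject_cycle A m F x y \<longleftrightarrow>
     (y, x) \<in> (strong_edges m F (m (x, y)))\<^sup>* \<and>
     (\<forall>u\<in>A. (u, x) \<in> (strong_edges m F (m (x, y)))\<^sup>* \<longrightarrow>
        (y, u) \<in> {e \<in> dom F. m e > m (x, y) \<and> \<not> bad_edge m F y e}\<^sup>*)"
proof -
  have bad: "(F (c, d) = Some CC \<longrightarrow>
       (\<forall>q. is_path F d q c \<and> strength m q \<ge> ereal (real_of_int (m (c, d))) \<longrightarrow> y \<in> set q)) \<longleftrightarrow>
     \<not> bad_edge m F y (c, d)" for c d
    using ex_avoiding_path_iff_rtrancl[of F d c "\<lambda>e. m e \<ge> m (c, d)" y]
    by (auto simp: bad_edge_def strength_ge_iff)
  have "(\<exists>p. is_path F y p u \<and> strength m p > ereal (real_of_int (m (x, y))) \<and>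
      (\<forall>(c, d) \<in> path_edges p. \<not> bad_edge m F y (c, d))) \<longleftrightarrow>
    (\<exists>p. is_path F y p u \<and> (\<forall>e\<in>path_edges p. m e > m (x, y) \<and> \<not> bad_edge m F y e))" for u
    by (auto simp: strength_greater_iff)
  then show ?thesis
    unfolding reject_cycle_def Let_def bad strength_greater_iff ex_path_iff_rtrancl strong_edges_def
    by auto
qed


section \<open>The algorithm in the array language\<close>

definition FEq :: "tm \<Rightarrow> tm \<Rightarrow> fm" where
  "FEq t u = FAnd (FNot (FLess t u)) (FNot (FLess u t))"

definition FOr :: "fm \<Rightarrow> fm \<Rightarrow> fm" where
  "FOr f g = FNot (FAnd (FNot f) (FNot g))"

lemma FEq_simps [simp]:
  "fval n (FEq t u) \<rho> M \<longleftrightarrow> tval t \<rho> M = tval u \<rho> M"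
  "fwf X (FEq t u) \<longleftrightarrow> twf X t \<and> twf X u"
  "fm_mats (FEq t u) = tm_mats t \<union> tm_mats u"
  by (auto simp: FEq_def)

lemma FOr_simps [simp]:
  "fval n (FOr f g) \<rho> M \<longleftrightarrow> fval n f \<rho> M \<or> fval n g \<rho> M"
  "fwf X (FOr f g) \<longleftrightarrow> fwf X f \<and> fwf X g"
  "fm_mats (FOr f g) = fm_mats f \<union> fm_mats g"
  by (auto simp: FOr_def)

definition FPos :: "mat \<Rightarrow> nat \<Rightarrow> nat \<Rightarrow> fm" where
  "FPos a i j = FLess (Num 0) (Cell a i j)"

lemma FPos_simps [simp]:
  "fval n (FPos a i j) \<rho> M \<longleftrightarrow> 0 < M a (\<rho> i) (\<rho> j)"
  "fwf X (FPos a i j) \<longleftrightarrow> i \<in> X \<and> j \<in> X"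
  "fm_mats (FPos a i j) = {a}"
  by (auto simp: FPos_def)

text \<open>Throughout, variables 2 and 3 hold the tail and the head of the current edge.\<close>

definition f_not_dominated :: fm where
  "f_not_dominated = FNot (FEx 6 (FPos State 6 3))"

definition f_fixedly_dominated :: fm where
  "f_fixedly_dominated = FEx 6 (FOr
     (FAnd (FEq (Cell State 6 3) (Num 1)) (FNot (FEx 7 (FAnd (FPos State 7 3) (FNot (FSame 7 6))))))
     (FOr (FEq (Cell State 6 3) (Num 2)) (FEq (Cell State 6 3) (Num 4))))"

definition f_cycle_dominated :: fm where
  "f_cycle_dominated = FAnd (FEx 6 (FPos State 6 3))
     (FNot (FEx 6 (FAnd (FPos State 6 3) (FNot (FEq (Cell State 6 3) (Num 3))))))"

definition f_stronger_incoming :: fm where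
  "f_stronger_incoming = FEx 6 (FAnd (FPos State 6 3) (FLess (Cell Weight 2 3) (Cell Weight 6 3)))"

definition f_equal_incoming :: fm where
  "f_equal_incoming =
     FNot (FEx 6 (FAnd (FPos State 6 3) (FNot (FEq (Cell Weight 6 3) (Cell Weight 2 3)))))"

definition f_strong_edge :: fm where
  "f_strong_edge = FAnd (FPos State 14 11) (FLess (Cell Weight 2 3) (Cell Weight 14 11))"

text \<open>The graph in which a path from variable 5 to variable 4 shows that the edge from 4 to 5,
  if it has state \<open>CC\<close>, is forbidden for the current head, variable 3.\<close>

definition f_avoiding_edge :: fm where
  "f_avoiding_edge = FAnd (FPos State 14 11)
     (FAnd (FNot (FLess (Cell Weight 14 11) (Cell Weight 4 5)))
       (FAnd (FNot (FSame 14 3)) (FNot (FSame 11 3))))"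

text \<open>The margin threshold varies with the edge under test, so the closure is recomputed for
  every pair, although only one of its entries is then read.\<close>

definition p_bad_edge :: prog where
  "p_bad_edge = PSeq (reach Reach2 f_avoiding_edge)
     (PIf (FAnd (FEq (Cell State 4 5) (Num 3)) (FAnd (FNot (FSame 5 3)) (FPos Reach2 5 4)))
       (PSet Bad 4 5 (Num 1)) (PSet Bad 4 5 (Num 0)))"

text \<open>A formula passed to \<open>reach\<close> can look up matrices but cannot run a
  reachability computation of its own; \<open>Bad\<close> must therefore be complete before
  \<open>Reach3\<close> is started. \<open>Reach1\<close>, which answers all questions about the set
  U, is kept apart from \<open>Reach2\<close>, the scratch space of
  \<open>p_bad_edge\<close>.\<close>

definition p_reach :: prog where
  "p_reach = PSeq (reach Reach1 f_strong_edge) (PSeq (PFor 4 (PFor 5 p_bad_edge))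
     (reach Reach3 (FAnd f_strong_edge (FNot (FPos Bad 14 11)))))"

definition f_reject_cycle :: fm where
  "f_reject_cycle = FAnd (FPos Reach1 3 2)
     (FNot (FEx 6 (FAnd (FPos Reach1 6 2) (FNot (FPos Reach3 3 6)))))"

definition p_add_edge :: prog where
  "p_add_edge =
     PIf f_not_dominated (PSet State 2 3 (Num 1))
     (PIf (FAnd f_cycle_dominated f_stronger_incoming) (PSet State 2 3 (Num 4))
     (PIf (FAnd f_cycle_dominated f_equal_incoming) (PSet State 2 3 (Num 2))
     (PSeq (PFor 6 (PIf (FEq (Cell State 6 3) (Num 1)) (PSet State 6 3 (Num 2)) PSkip))
       (PSet State 2 3 (Num 2)))))"

definition f_on_cycle :: fm where
  "f_on_cycle = FAnd (FPos State 6 7) (FAnd (FPos Reach2 3 6) (FPos Reach2 7 2))"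

text \<open>One closure suffices, as marking alters states but no edges. \<open>Reach2\<close> is
  free for it, the rejection tests being over.\<close>

definition p_mark_cycles :: prog where
  "p_mark_cycles = PSeq (reach Reach2 (FPos State 14 11))
     (PIf (FEx 6 (FEx 7 f_on_cycle))
       (PSeq (PFor 6 (PFor 7
           (PIf (FAnd f_on_cycle (FEq (Cell Weight 6 7) (Cell Weight 2 3))) (PSet State 6 7 (Num 3)) PSkip)))
         (PSet State 2 3 (Num 3)))
       PSkip)"

definition p_step :: prog where
  "p_step = PIf (FAnd f_fixedly_dominated f_stronger_incoming) PSkip
     (PSeq p_reach (PIf f_reject_cycle PSkip (PSeq p_add_edge p_mark_cycles)))"

definition f_next_edge :: fm where
  "f_next_edge = FAnd (FPos Todo 2 3) (FNot (FEx 4 (FEx 5 (FAnd (FPos Todo 4 5)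
     (FOr (FLess (Cell Weight 2 3) (Cell Weight 4 5))
       (FAnd (FEq (Cell Weight 2 3) (Cell Weight 4 5)) (FLess (Cell Rank 4 5) (Cell Rank 2 3))))))))"

definition p_sweep :: prog where
  "p_sweep = PFor 2 (PFor 3 (PIf f_next_edge (PSeq (PSet Todo 2 3 (Num 0)) p_step) PSkip))"

text \<open>All storage is square, so a vector is kept on a diagonal. The loop uses variable 3
  because the domination formulas speak about that variable.\<close>

definition p_winners :: prog where
  "p_winners = PFor 3 (PIf (FOr f_cycle_dominated f_not_dominated) (PSet Winner 3 3 (Num 1)) PSkip)"

definition p_main :: prog where
  "p_main = PSeq (PFor 0 (PFor 1 p_sweep)) p_winners"

lemma pwf_p_main: "pwf {} p_main"
  by (simp add: p_main_def p_winners_def p_sweep_def f_next_edge_def p_step_def p_mark_cycles_def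
      f_on_cycle_def p_add_edge_def f_reject_cycle_def p_reach_def p_bad_edge_def f_avoiding_edge_def
      f_strong_edge_def f_equal_incoming_def f_stronger_incoming_def f_cycle_dominated_def
      f_fixedly_dominated_def f_not_dominated_def reach_def)

lemma state_code_eq_iff [simp]:
  "state_code st = 1 \<longleftrightarrow> st = Some Fix" "state_code st = 2 \<longleftrightarrow> st = Some BC"
  "state_code st = 3 \<longleftrightarrow> st = Some CC" "state_code st = 4 \<longleftrightarrow> st = Some CBC"
  "0 < state_code st \<longleftrightarrow> st \<noteq> None"
  by (cases st rule: state_code.cases; simp)+

section \<open>Correctness of the array programs on a numbered graph\<close>

locale numbered_graph =
  fixes A :: "'a set" and E :: "('a \<times> 'a) set" and m rank :: "'a \<times> 'a \<Rightarrow> int"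
    and v :: "nat \<Rightarrow> 'a" and n :: nat
  assumes bij_v: "bij_betw v {..<n} A" and E_subset: "E \<subseteq> A \<times> A"
begin

lemma v_in [simp]: "i < n \<Longrightarrow> v i \<in> A"
  using bij_v by (auto simp: bij_betw_def)

lemma v_eq_iff [simp]: "i < n \<Longrightarrow> j < n \<Longrightarrow> v i = v j \<longleftrightarrow> i = j"
  using bij_v by (auto simp: bij_betw_def inj_on_def)

lemma v_surj: "x \<in> A \<Longrightarrow> \<exists>i<n. x = v i"
  using bij_v by (auto simp: bij_betw_def)

lemma bex_A: "(\<exists>x\<in>A. Q x) \<longleftrightarrow> (\<exists>i<n. Q (v i))"
  using v_surj by auto

text \<open>Closure commutes with numbering because R stays within A: each intermediate vertex of a
  walk has a number below n.\<close>

lemma rtrancl_index: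
  assumes R: "R \<subseteq> A \<times> A" and ij: "i < n" "j < n"
  shows "(i, j) \<in> {(k, l). k < n \<and> l < n \<and> (v k, v l) \<in> R}\<^sup>* \<longleftrightarrow> (v i, v j) \<in> R\<^sup>*" (is "_ \<in> ?S\<^sup>* \<longleftrightarrow> _")
proof
  assume "(i, j) \<in> ?S\<^sup>*"
  then show "(v i, v j) \<in> R\<^sup>*"
    by (induction rule: rtrancl_induct) (auto intro: rtrancl_into_rtrancl)
next
  have "\<forall>j<n. w = v j \<longrightarrow> (i, j) \<in> ?S\<^sup>*" if "(v i, w) \<in> R\<^sup>*" for w
    using that
  proof (induction rule: rtrancl_induct)
    case base
    with ij show ?case by auto
  next
    case (step w z)
    show ?case
    proof (intro allI impI)
      fix l assume l: "l < n" "z = v l"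
      from step.hyps(2) R have "w \<in> A" by auto
      then obtain k where k: "k < n" "w = v k" using v_surj by blast
      with step.IH have "(i, k) \<in> ?S\<^sup>*" by simp
      moreover have "(k, l) \<in> ?S" using k l step.hyps(2) by simp
      ultimately show "(i, l) \<in> ?S\<^sup>*" by (rule rtrancl_into_rtrancl)
    qed
  qed
  then show "(v i, v j) \<in> R\<^sup>* \<Longrightarrow> (i, j) \<in> ?S\<^sup>*" using ij by blast
qed

text \<open>Weights and ranks are prescribed on E only, since the input holds no others;
  \<open>dom F\<close> being part of E makes them available for every edge of the diagram.\<close>

definition encodes :: "'a diagram \<Rightarrow> mats \<Rightarrow> bool" where
  "encodes F M \<longleftrightarrow> dom F \<subseteq> E \<and>
     (\<forall>i<n. \<forall>j<n. M State i j = state_code (F (v i, v j)) \<and>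
        ((v i, v j) \<in> E \<longrightarrow> M Weight i j = m (v i, v j) \<and> M Rank i j = rank (v i, v j)))"

lemma encodes_cong:
  "encodes F M \<Longrightarrow> M' State = M State \<Longrightarrow> M' Weight = M Weight \<Longrightarrow> M' Rank = M Rank \<Longrightarrow> encodes F M'"
  by (simp add: encodes_def)

lemma bex_incoming:
  assumes "dom F \<subseteq> E" "j < n"
  shows "(\<exists>e\<in>incoming F (v j). Q e) \<longleftrightarrow> (\<exists>i<n. F (v i, v j) \<noteq> None \<and> Q (v i, v j))"
proof
  assume "\<exists>e\<in>incoming F (v j). Q e"
  then obtain x where x: "(x, v j) \<in> dom F" "Q (x, v j)" by (force simp: incoming_def)
  with assms(1) E_subset have "x \<in> A" by auto
  then obtain i where "i < n" "x = v i" using v_surj by blast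
  with x show "\<exists>i<n. F (v i, v j) \<noteq> None \<and> Q (v i, v j)" by blast
qed (force simp: incoming_def)

lemma dom_F: "encodes F M \<Longrightarrow> dom F \<subseteq> E"
  by (simp add: encodes_def)

lemma M_State: "encodes F M \<Longrightarrow> i < n \<Longrightarrow> j < n \<Longrightarrow> M State i j = state_code (F (v i, v j))"
  by (simp add: encodes_def)

lemma M_Weight:
  "encodes F M \<Longrightarrow> i < n \<Longrightarrow> j < n \<Longrightarrow> (v i, v j) \<in> E \<Longrightarrow> M Weight i j = m (v i, v j)"
  by (simp add: encodes_def)

lemma M_Weight_dom:
  "encodes F M \<Longrightarrow> i < n \<Longrightarrow> j < n \<Longrightarrow> F (v i, v j) \<noteq> None \<Longrightarrow> M Weight i j = m (v i, v j)"
  by (auto simp: encodes_def)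

lemma fval_not_dominated:
  assumes "encodes F M" "\<rho> 3 < n"
  shows "fval n f_not_dominated \<rho> M \<longleftrightarrow> not_dominated F (v (\<rho> 3))"
proof -
  have "fval n f_not_dominated \<rho> M \<longleftrightarrow> \<not> (\<exists>e\<in>incoming F (v (\<rho> 3)). True)"
    unfolding bex_incoming[OF dom_F[OF assms(1)] assms(2)] using assms
    by (simp add: f_not_dominated_def M_State cong: conj_cong)
  then show ?thesis by (auto simp: not_dominated_def)
qed

lemma fval_cycle_dominated:
  assumes "encodes F M" "\<rho> 3 < n"
  shows "fval n f_cycle_dominated \<rho> M \<longleftrightarrow> cycle_dominated F (v (\<rho> 3))"
proof -
  have "fval n f_cycle_dominated \<rho> M \<longleftrightarrow>
      (\<exists>e\<in>incoming F (v (\<rho> 3)). True) \<and> \<not> (\<exists>e\<in>incoming F (v (\<rho> 3)). F e \<noteq> Some CC)"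
    unfolding bex_incoming[OF dom_F[OF assms(1)] assms(2)] using assms
    by (simp add: f_cycle_dominated_def M_State cong: conj_cong)
  then show ?thesis by (auto simp: cycle_dominated_def)
qed

lemma fval_fixedly_dominated:
  assumes "encodes F M" "\<rho> 3 < n"
  shows "fval n f_fixedly_dominated \<rho> M \<longleftrightarrow> fixedly_dominated F (v (\<rho> 3))"
proof -
  let ?y = "v (\<rho> 3)"
  have "fval n f_fixedly_dominated \<rho> M \<longleftrightarrow>
      (\<exists>k<n. (F (v k, ?y) = Some Fix \<and> \<not> (\<exists>l<n. F (v l, ?y) \<noteq> None \<and> l \<noteq> k)) \<or>
        F (v k, ?y) = Some BC \<or> F (v k, ?y) = Some CBC)"
    using assms by (simp add: f_fixedly_dominated_def M_State cong: conj_cong)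
  also have "\<dots> \<longleftrightarrow> (\<exists>k<n. F (v k, ?y) \<noteq> None \<and> F (v k, ?y) = Some Fix \<and>
        \<not> (\<exists>l<n. F (v l, ?y) \<noteq> None \<and> (v l, ?y) \<noteq> (v k, ?y))) \<or>
      (\<exists>k<n. F (v k, ?y) \<noteq> None \<and> (F (v k, ?y) = Some BC \<or> F (v k, ?y) = Some CBC))"
    by (simp cong: conj_cong) blast
  also have "\<dots> \<longleftrightarrow> fixedly_dominated F ?y"
  proof -
    \<comment> \<open>Being the only incoming edge is restated with bounded quantifiers, the form
      that \<open>bex_incoming\<close> transfers to vertex numbers.\<close>
    have single: "(\<exists>e. incoming F ?y = {e} \<and> F e = Some Fix) \<longleftrightarrow>
      (\<exists>e\<in>incoming F ?y. F e = Some Fix \<and> \<not> (\<exists>e'\<in>incoming F ?y. e' \<noteq> e))"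
      by auto
    show ?thesis
      unfolding fixedly_dominated_def single bex_incoming[OF dom_F[OF assms(1)] assms(2)] ..
  qed
  finally show ?thesis .
qed

context
  fixes F :: "'a diagram" and M :: mats and \<rho> :: env and x y :: nat
  assumes enc: "encodes F M" and x: "\<rho> 2 = x" "x < n" and y: "\<rho> 3 = y" "y < n"
    and xy: "(v x, v y) \<in> E"
begin

lemmas M_facts = M_State[OF enc] M_Weight[OF enc] M_Weight_dom[OF enc]

lemma fval_stronger_incoming:
  "fval n f_stronger_incoming \<rho> M \<longleftrightarrow> (\<exists>e\<in>incoming F (v y). m e > m (v x, v y))"
  using xy x y
  by (simp add: bex_incoming[OF dom_F[OF enc]] f_stronger_incoming_def M_facts cong: conj_cong)

lemma fval_equal_incoming:
  "fval n f_equal_incoming \<rho> M \<longleftrightarrow> (\<forall>e\<in>incoming F (v y). m e = m (v x, v y))"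
proof -
  have "fval n f_equal_incoming \<rho> M \<longleftrightarrow> \<not> (\<exists>e\<in>incoming F (v y). m e \<noteq> m (v x, v y))"
    unfolding bex_incoming[OF dom_F[OF enc] y(2)] using xy x y
    by (simp add: f_equal_incoming_def M_facts cong: conj_cong)
  then show ?thesis by blast
qed

text \<open>The bridge from \<open>psem_reach\<close> to the diagram: each use of
  \<open>reach\<close> only has to identify the relation that its edge formula describes.\<close>

lemma edge_set_index:
  assumes "\<And>k l. k < n \<Longrightarrow> l < n \<Longrightarrow> fval n g (\<rho>'(14 := k, 11 := l)) M' \<longleftrightarrow> (v k, v l) \<in> R"
    and "R \<subseteq> dom F" "i < n" "j < n"
  shows "(i, j) \<in> {(k, l). k < n \<and> l < n \<and> fval n g (\<rho>'(14 := k, 11 := l)) M'}\<^sup>* \<longleftrightarrow> (v i, v j) \<in> R\<^sup>*"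
proof -
  have eq: "{(k, l). k < n \<and> l < n \<and> fval n g (\<rho>'(14 := k, 11 := l)) M'} =
      {(k, l). k < n \<and> l < n \<and> (v k, v l) \<in> R}"
    using assms(1) by auto
  have "R \<subseteq> A \<times> A" using assms(2) dom_F[OF enc] E_subset by blast
  then show ?thesis unfolding eq using assms(3,4) by (rule rtrancl_index)
qed

lemma psem_bad_edge:
  assumes M': "M' State = M State" "M' Weight = M Weight"
    and cd: "c < n" "d < n"
  shows "b \<noteq> Bad \<Longrightarrow> b \<noteq> Reach2 \<Longrightarrow> psem n p_bad_edge (\<rho>(4 := c, 5 := d)) M' b = M' b"
    and "psem n p_bad_edge (\<rho>(4 := c, 5 := d)) M' Bad =
      (M' Bad)(c := (M' Bad c)(d := of_bool (bad_edge m F (v y) (v c, v d))))"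
proof -
  let ?\<rho> = "\<rho>(4 := c, 5 := d)"
  let ?M = "psem n (reach Reach2 f_avoiding_edge) ?\<rho> M'"
  have wf: "fwf {3, 4, 5, 11, 14} f_avoiding_edge" by (simp add: f_avoiding_edge_def)
  have disj: "{3, 4, 5, 11, 14} \<inter> {10, 12, 13} = ({} :: nat set)" by simp
  have mats: "Reach2 \<notin> fm_mats f_avoiding_edge" by (simp add: f_avoiding_edge_def)
  note sem = psem_reach[OF wf disj mats]
  \<comment> \<open>Only an edge of the diagram has a meaningful threshold. For any other pair the
    closure is left unspecified, and the state test alone yields 0.\<close>
  have r: "?M Reach2 i j = of_bool ((v i, v j) \<in>
      {e \<in> dom F. m e \<ge> m (v c, v d) \<and> fst e \<noteq> v y \<and> snd e \<noteq> v y}\<^sup>*)"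
    if "F (v c, v d) \<noteq> None" "i < n" "j < n" for i j
  proof -
    have "(i, j) \<in> {(k, l). k < n \<and> l < n \<and> fval n f_avoiding_edge (?\<rho>(14 := k, 11 := l)) M'}\<^sup>* \<longleftrightarrow>
      (v i, v j) \<in> {e \<in> dom F. m e \<ge> m (v c, v d) \<and> fst e \<noteq> v y \<and> snd e \<noteq> v y}\<^sup>*"
      by (rule edge_set_index)
        (use that cd x y in \<open>auto simp: f_avoiding_edge_def M' M_facts\<close>)
    with that show ?thesis by (simp add: sem)
  qed
  show "b \<noteq> Bad \<Longrightarrow> b \<noteq> Reach2 \<Longrightarrow> psem n p_bad_edge ?\<rho> M' b = M' b"
    by (simp add: p_bad_edge_def sem)
  have "fval n (FAnd (FEq (Cell State 4 5) (Num 3)) (FAnd (FNot (FSame 5 3)) (FPos Reach2 5 4))) ?\<rho> ?M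
      \<longleftrightarrow> bad_edge m F (v y) (v c, v d)"
    using cd y r[of d c] by (auto simp: sem(1) M' M_facts bad_edge_def)
  then show "psem n p_bad_edge ?\<rho> M' Bad =
      (M' Bad)(c := (M' Bad c)(d := of_bool (bad_edge m F (v y) (v c, v d))))"
    by (simp add: p_bad_edge_def sem(1) del: fval.simps(4))
qed

lemma psem_p_reach:
  shows "b \<notin> {Bad, Reach1, Reach2, Reach3} \<Longrightarrow> psem n p_reach \<rho> M b = M b"
    and "fval n f_reject_cycle \<rho> (psem n p_reach \<rho> M) \<longleftrightarrow> reject_cycle A m F (v x) (v y)"
proof -
  let ?g = "FAnd f_strong_edge (FNot (FPos Bad 14 11))"
  define M1 where "M1 = psem n (reach Reach1 f_strong_edge) \<rho> M"
  define M2 where "M2 = psem n (PFor 4 (PFor 5 p_bad_edge)) \<rho> M1"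
  define M3 where "M3 = psem n (reach Reach3 ?g) \<rho> M2"
  have M3: "psem n p_reach \<rho> M = M3"
    by (simp only: p_reach_def M1_def M2_def M3_def psem.simps(3))
  have disj: "{2, 3, 11, 14} \<inter> {10, 12, 13} = ({} :: nat set)" by simp
  have wf1: "fwf {2, 3, 11, 14} f_strong_edge" and mats1: "Reach1 \<notin> fm_mats f_strong_edge"
    by (simp_all add: f_strong_edge_def)
  have wf3: "fwf {2, 3, 11, 14} ?g" and mats3: "Reach3 \<notin> fm_mats ?g"
    by (simp_all add: f_strong_edge_def)
  have sem1: "b \<noteq> Reach1 \<Longrightarrow> M1 b = M b" for b
    unfolding M1_def by (rule psem_reach(1)[OF wf1 disj mats1])
  have sem3: "b \<noteq> Reach3 \<Longrightarrow> M3 b = M2 b" for b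
    unfolding M3_def by (rule psem_reach(1)[OF wf3 disj mats3])
  \<comment> \<open>Every call overwrites \<open>Reach2\<close>, which is therefore declared as
    scratch.\<close>
  have cells: "(\<forall>b. b \<notin> insert Bad {Reach2} \<longrightarrow> psem n p_bad_edge (\<rho>(4 := k, 5 := l)) M' b = M1 b) \<and>
      psem n p_bad_edge (\<rho>(4 := k, 5 := l)) M' Bad =
        (M' Bad)(k := (M' Bad k)(l := of_bool (bad_edge m F (v y) (v k, v l))))"
    if "k < n" "l < n" "\<And>b. b \<notin> insert Bad {Reach2} \<Longrightarrow> M' b = M1 b" for k l M'
    using psem_bad_edge[of M' k l] that sem1 by auto
  have sem2: "b \<notin> insert Bad {Reach2} \<Longrightarrow> M2 b = M1 b" for b
    unfolding M2_def by (rule psem_cells(1)) (rule cells)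
  have "M2 Bad = (\<lambda>k l. if k < n \<and> l < n then of_bool (bad_edge m F (v y) (v k, v l)) else M1 Bad k l)"
    unfolding M2_def by (rule psem_cells(2)) (rule cells)
  then have bad: "M2 Bad k l = of_bool (bad_edge m F (v y) (v k, v l))" if "k < n" "l < n" for k l
    using that by simp
  show "b \<notin> {Bad, Reach1, Reach2, Reach3} \<Longrightarrow> psem n p_reach \<rho> M b = M b"
    by (simp add: M3 sem3 sem2 sem1)
  have "M1 Reach1 i j = of_bool ((v i, v j) \<in> (strong_edges m F (m (v x, v y)))\<^sup>*)"
    if "i < n" "j < n" for i j
  proof -
    have "(i, j) \<in> {(k, l). k < n \<and> l < n \<and> fval n f_strong_edge (\<rho>(14 := k, 11 := l)) M}\<^sup>* \<longleftrightarrow>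
      (v i, v j) \<in> (strong_edges m F (m (v x, v y)))\<^sup>*"
      by (rule edge_set_index)
        (use that x y xy in \<open>auto simp: f_strong_edge_def strong_edges_def M_facts\<close>)
    with that show ?thesis by (simp add: M1_def psem_reach(2)[OF wf1 disj mats1])
  qed
  then have r1: "M3 Reach1 i j = of_bool ((v i, v j) \<in> (strong_edges m F (m (v x, v y)))\<^sup>*)"
    if "i < n" "j < n" for i j
    using that by (simp add: sem3 sem2)
  have r3: "M3 Reach3 i j = of_bool ((v i, v j) \<in>
      {e \<in> dom F. m e > m (v x, v y) \<and> \<not> bad_edge m F (v y) e}\<^sup>*)"
    if "i < n" "j < n" for i j
  proof -
    have "(i, j) \<in> {(k, l). k < n \<and> l < n \<and> fval n ?g (\<rho>(14 := k, 11 := l)) M2}\<^sup>* \<longleftrightarrow>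
      (v i, v j) \<in> {e \<in> dom F. m e > m (v x, v y) \<and> \<not> bad_edge m F (v y) e}\<^sup>*"
      by (rule edge_set_index)
        (use that x y xy in \<open>auto simp: f_strong_edge_def sem2 sem1 M_facts bad\<close>)
    with that show ?thesis by (simp add: M3_def psem_reach(2)[OF wf3 disj mats3])
  qed
  have ball: "(\<forall>u\<in>A. Q u) \<longleftrightarrow> (\<forall>i<n. Q (v i))" for Q
    using bex_A[of "\<lambda>u. \<not> Q u"] by blast
  show "fval n f_reject_cycle \<rho> (psem n p_reach \<rho> M) \<longleftrightarrow> reject_cycle A m F (v x) (v y)"
    unfolding reject_cycle_iff ball M3 using x y by (auto simp: f_reject_cycle_def r1 r3)
qed

lemma psem_p_add_edge: "encodes (add_edge m F (v x) (v y)) (psem n p_add_edge \<rho> M)"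
  and psem_p_add_edge_frame: "b \<noteq> State \<Longrightarrow> psem n p_add_edge \<rho> M b = M b"
proof -
  define l where "l = PFor 6 (PIf (FEq (Cell State 6 3) (Num 1)) (PSet State 6 3 (Num 2)) PSkip)"
  \<comment> \<open>The recoding of \<open>Fix\<close> (1) as \<open>BC\<close> (2) runs down column
    y, whose rows are the tails of the edges into y.\<close>
  define R where "R = (\<lambda>k M'. (\<forall>b. b \<noteq> State \<longrightarrow> M' b = M b) \<and>
    (\<forall>i<n. \<forall>j<n. M' State i j = (if i < k \<and> j = y \<and> M State i j = 1 then 2 else M State i j)))"
  have "R n (psem n l \<rho> M)"
    unfolding l_def psem.simps
  proof (rule fold_upt_induct[where P = R])
    fix k M' assume "k < n" "R k M'"
    then show "R (Suc k) (if fval n (FEq (Cell State 6 3) (Num 1)) (\<rho>(6 := k)) M'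
          then M'(State := (M' State)((\<rho>(6 := k)) 6 := (M' State ((\<rho>(6 := k)) 6))
            ((\<rho>(6 := k)) 3 := tval (Num 2) (\<rho>(6 := k)) M'))) else M')"
      using y by (auto simp: R_def less_Suc_eq)
  qed (simp add: R_def)
  then have l: "\<forall>b. b \<noteq> State \<longrightarrow> psem n l \<rho> M b = M b" "\<forall>i<n. \<forall>j<n. psem n l \<rho> M State i j =
      (if j = y \<and> F (v i, v j) = Some Fix then 2 else state_code (F (v i, v j)))"
    by (auto simp: R_def M_facts)
  have y3: "\<rho> 3 < n" using y by simp
  note fv = fval_not_dominated[of F M \<rho>, OF enc y3] fval_cycle_dominated[of F M \<rho>, OF enc y3] fval_stronger_incoming
    fval_equal_incoming
  let ?F = "\<lambda>e. if e \<in> incoming F (v y) \<and> F e = Some Fix then Some BC else F e"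
  have psem: "psem n p_add_edge \<rho> M =
    (let put = (\<lambda>M z. M(State := (M State)(x := (M State x)(y := z)))) in
     if not_dominated F (v y) then put M 1
     else if cycle_dominated F (v y) \<and> (\<exists>e\<in>incoming F (v y). m e > m (v x, v y)) then put M 4
     else if cycle_dominated F (v y) \<and> (\<forall>e\<in>incoming F (v y). m e = m (v x, v y)) then put M 2
     else put (psem n l \<rho> M) 2)"
    unfolding p_add_edge_def l_def[symmetric] psem.simps(1-4) fval.simps(4) fv
    by (auto simp: x y Let_def)
  then show "b \<noteq> State \<Longrightarrow> psem n p_add_edge \<rho> M b = M b"
    using l(1) by (auto simp: Let_def)
  have put: "encodes (G((v x, v y) \<mapsto> st)) (M'(State := (M' State)(x := (M' State x)(y := z))))"
    if "encodes G M'" "state_code (Some st) = z" for G M' st z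
    using that x y xy by (auto simp: encodes_def)
  have "encodes ?F (psem n l \<rho> M)"
    using l enc y by (auto simp: encodes_def incoming_def split: if_splits)
  from put[OF this, of BC 2] put[OF enc, of Fix 1] put[OF enc, of CBC 4] put[OF enc, of BC 2]
  show "encodes (add_edge m F (v x) (v y)) (psem n p_add_edge \<rho> M)"
    unfolding psem add_edge_def Let_def by auto
qed

lemma psem_p_mark_cycles: "encodes (mark_cycles m F (v x) (v y)) (psem n p_mark_cycles \<rho> M)"
  and psem_p_mark_cycles_frame: "b \<noteq> State \<Longrightarrow> b \<noteq> Reach2 \<Longrightarrow> psem n p_mark_cycles \<rho> M b = M b"
proof -
  let ?C = "cycle_edges F (v x) (v y)"
  define M1 where "M1 = psem n (reach Reach2 (FPos State 14 11)) \<rho> M"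
  define g where "g = FAnd f_on_cycle (FEq (Cell Weight 6 7) (Cell Weight 2 3))"
  define M2 where "M2 = psem n (PFor 6 (PFor 7 (PIf g (PSet State 6 7 (Num 3)) PSkip))) \<rho> M1"
  have disj: "{11, 14} \<inter> {10, 12, 13} = ({} :: nat set)" by simp
  have wf: "fwf {11, 14} (FPos State 14 11)" and mats: "Reach2 \<notin> fm_mats (FPos State 14 11)"
    by simp_all
  have sem1: "b \<noteq> Reach2 \<Longrightarrow> M1 b = M b" for b
    unfolding M1_def by (rule psem_reach(1)[OF wf disj mats])
  have r: "M1 Reach2 i j = of_bool ((v i, v j) \<in> (dom F)\<^sup>*)" if "i < n" "j < n" for i j
  proof -
    have "(i, j) \<in> {(k, l). k < n \<and> l < n \<and> fval n (FPos State 14 11) (\<rho>(14 := k, 11 := l)) M}\<^sup>* \<longleftrightarrow>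
      (v i, v j) \<in> (dom F)\<^sup>*"
      by (rule edge_set_index) (use that in \<open>auto simp: M_facts\<close>)
    with that show ?thesis by (simp add: M1_def psem_reach(2)[OF wf disj mats])
  qed
  have on_cycle: "fval n f_on_cycle (\<rho>(6 := k, 7 := l)) M' \<longleftrightarrow> (v k, v l) \<in> ?C"
    if "k < n" "l < n" "M' State k l = M State k l" "M' Reach2 = M1 Reach2" for k l M'
    using that x y by (auto simp: f_on_cycle_def cycle_edges_def M_facts r)
  have C_nonempty: "fval n (FEx 6 (FEx 7 f_on_cycle)) \<rho> M1 \<longleftrightarrow> ?C \<noteq> {}"
  proof -
    have "?C \<subseteq> A \<times> A" using dom_F[OF enc] E_subset by (fastforce simp: cycle_edges_def domIff)
    then have "?C \<noteq> {} \<longleftrightarrow> (\<exists>a\<in>A. \<exists>b\<in>A. (a, b) \<in> ?C)" by auto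
    also have "\<dots> \<longleftrightarrow> (\<exists>k<n. \<exists>l<n. (v k, v l) \<in> ?C)" by (simp only: bex_A)
    also have "\<dots> \<longleftrightarrow> fval n (FEx 6 (FEx 7 f_on_cycle)) \<rho> M1"
      using on_cycle[of _ _ M1] by (simp add: sem1 cong: conj_cong)
    finally show ?thesis by simp
  qed
  have g: "fval n g (\<rho>(6 := k, 7 := l)) M' \<longleftrightarrow> (v k, v l) \<in> ?C \<and> m (v k, v l) = m (v x, v y)"
    if "k < n" "l < n" "M' State k l = M State k l" "M' Reach2 = M1 Reach2" "M' Weight = M Weight"
    for k l M'
  proof -
    have "M Weight k l = m (v k, v l)" if "(v k, v l) \<in> ?C"
      using that \<open>k < n\<close> \<open>l < n\<close> by (auto simp: cycle_edges_def M_facts)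
    then show ?thesis
      using on_cycle[OF that(1-4)] that x y xy by (auto simp: g_def M_facts)
  qed
  have cells: "(\<forall>b. b \<notin> insert State {} \<longrightarrow>
        psem n (PIf g (PSet State 6 7 (Num 3)) PSkip) (\<rho>(6 := k, 7 := l)) M' b = M1 b) \<and>
      psem n (PIf g (PSet State 6 7 (Num 3)) PSkip) (\<rho>(6 := k, 7 := l)) M' State =
        (M' State)(k := (M' State k)(l := 
          if (v k, v l) \<in> ?C \<and> m (v k, v l) = m (v x, v y) then 3 else M State k l))"
    if "k < n" "l < n" "\<And>b. b \<notin> insert State {} \<Longrightarrow> M' b = M1 b" "M' State k l = M1 State k l" for k l M'
  proof -
    \<comment> \<open>Leaving a cell alone is presented as writing back its old value, to fit the
      single-cell update of \<open>psem_cells\<close>.\<close>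
    have "(M' State)(k := (M' State k)(l := M State k l)) = M' State"
      using that(4) sem1 by (metis fun_upd_triv mat.distinct)
    with g[of k l M'] that sem1 show ?thesis by auto
  qed
  have sem2: "b \<noteq> State \<Longrightarrow> M2 b = M1 b" for b
    unfolding M2_def by (rule psem_cells(1)[where a = State and B = "{}"], rule cells) auto
  have M2_State: "M2 State = (\<lambda>k l. if k < n \<and> l < n then
      if (v k, v l) \<in> ?C \<and> m (v k, v l) = m (v x, v y) then 3 else M State k l else M1 State k l)"
    unfolding M2_def by (rule psem_cells(2)[where B = "{}"], rule cells) auto
  have psem: "psem n p_mark_cycles \<rho> M =
    (if ?C = {} then M1 else M2(State := (M2 State)(x := (M2 State x)(y := 3))))"
    unfolding p_mark_cycles_def psem.simps(1-4) M1_def[symmetric] C_nonempty g_def[symmetric]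
      M2_def[symmetric] by (simp add: x y)
  show "b \<noteq> State \<Longrightarrow> b \<noteq> Reach2 \<Longrightarrow> psem n p_mark_cycles \<rho> M b = M b"
    by (simp add: psem sem1 sem2)
  have "?C \<subseteq> dom F" by (auto simp: cycle_edges_def)
  then have "dom (mark_cycles m F (v x) (v y)) \<subseteq> E"
    using dom_F[OF enc] xy by (fastforce simp: mark_cycles_def split: if_splits)
  then show "encodes (mark_cycles m F (v x) (v y)) (psem n p_mark_cycles \<rho> M)"
    using enc x y unfolding encodes_def psem
    by (auto simp: mark_cycles_def sem1 sem2 M2_State)
qed

end

lemma psem_p_step:
  assumes enc: "encodes F M" and lt: "\<rho> 2 < n" "\<rho> 3 < n" and xy: "(v (\<rho> 2), v (\<rho> 3)) \<in> E"
  shows "encodes (fun_step A m (v (\<rho> 2), v (\<rho> 3)) F) (psem n p_step \<rho> M)"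
    and "b \<in> {Todo, Winner} \<Longrightarrow> psem n p_step \<rho> M b = M b"
proof -
  note [simp del] = psem.simps(5)
  note ctx = lt(1) refl lt(2) xy
  define M1 where "M1 = psem n p_reach \<rho> M"
  define M2 where "M2 = psem n p_add_edge \<rho> M1"
  define M3 where "M3 = psem n p_mark_cycles \<rho> M2"
  have M1: "b \<notin> {Bad, Reach1, Reach2, Reach3} \<Longrightarrow> M1 b = M b" for b
    unfolding M1_def by (rule psem_p_reach(1)[OF enc refl ctx])
  have enc1: "encodes F M1" by (rule encodes_cong[OF enc]) (simp_all add: M1)
  have enc2: "encodes (add_edge m F (v (\<rho> 2)) (v (\<rho> 3))) M2"
    unfolding M2_def by (rule psem_p_add_edge[OF enc1 refl ctx])
  have enc3: "encodes (mark_cycles m (add_edge m F (v (\<rho> 2)) (v (\<rho> 3))) (v (\<rho> 2)) (v (\<rho> 3))) M3"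
    unfolding M3_def by (rule psem_p_mark_cycles[OF enc2 refl ctx])
  have frame: "M2 b = M b" "M3 b = M b" if "b \<in> {Todo, Winner}" for b
    using that psem_p_add_edge_frame[OF enc1 refl ctx, of b]
      psem_p_mark_cycles_frame[OF enc2 refl ctx, of b]
    by (auto simp: M1 M2_def M3_def)
  have dominated: "fval n (FAnd f_fixedly_dominated f_stronger_incoming) \<rho> M \<longleftrightarrow>
      reject_dominated m F (v (\<rho> 2)) (v (\<rho> 3))"
    unfolding fval.simps(4) fval_fixedly_dominated[of F M \<rho>, OF enc lt(2)]
      fval_stronger_incoming[OF enc refl ctx] reject_dominated_def ..
  have psem: "psem n p_step \<rho> M = (if reject_dominated m F (v (\<rho> 2)) (v (\<rho> 3)) then M
      else if reject_cycle A m F (v (\<rho> 2)) (v (\<rho> 3)) then M1 else M3)"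
    unfolding p_step_def psem.simps(1-4) dominated psem_p_reach(2)[OF enc refl ctx]
    by (simp add: M1_def M2_def M3_def)
  show "encodes (fun_step A m (v (\<rho> 2), v (\<rho> 3)) F) (psem n p_step \<rho> M)"
    using enc enc1 enc3 unfolding psem fun_step_def by simp
  show "b \<in> {Todo, Winner} \<Longrightarrow> psem n p_step \<rho> M b = M b"
    using frame[of b] M1[of b] by (auto simp: psem)
qed

section \<open>Sweeps and the processing order\<close>

definition precedes :: "'a \<times> 'a \<Rightarrow> 'a \<times> 'a \<Rightarrow> bool" where
  "precedes e f \<longleftrightarrow> m e > m f \<or> m e = m f \<and> rank e \<le> rank f"

definition next_edge :: "('a \<times> 'a) list \<Rightarrow> 'a \<times> 'a \<Rightarrow> bool" where
  "next_edge es e \<longleftrightarrow> e \<in> E - set es \<and> (\<forall>f\<in>E - set es. precedes e f)"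

text \<open>The list es is the history of the run. That each processed edge precedes each remaining
  one is what keeps the list sorted when a further edge is appended.\<close>

definition progress :: "('a \<times> 'a) list \<Rightarrow> mats \<Rightarrow> bool" where
  "progress es M \<longleftrightarrow> distinct es \<and> set es \<subseteq> E \<and> sorted_wrt precedes es \<and>
     (\<forall>e\<in>set es. \<forall>f\<in>E - set es. precedes e f) \<and> encodes (fun_diagram A m es) M \<and>
     (\<forall>i<n. \<forall>j<n. M Todo i j = of_bool ((v i, v j) \<in> E - set es)) \<and> M Winner = (\<lambda>_ _. 0)"

lemma finite_E: "finite E"
  using E_subset bij_v bij_betw_finite finite_subset by (metis finite_SigmaI finite_lessThan)

lemma card_E: "card E \<le> n * n"
proof -
  have A: "finite A" "card A = n"
    using bij_v bij_betw_finite bij_betw_same_card by fastforce+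
  with card_mono[OF _ E_subset] show ?thesis by (simp add: card_cartesian_product)
qed

lemma ex_next_edge:
  assumes "set es \<subset> E"
  shows "\<exists>e. next_edge es e"
proof -
  define S where "S = E - set es"
  have fin: "finite S" "S \<noteq> {}" using assms finite_E by (auto simp: S_def)
  have "\<exists>e\<in>S. \<forall>f\<in>S. precedes e f"
    using fin
  proof (induction S rule: finite_ne_induct)
    case (insert e S)
    then obtain e' where e': "e' \<in> S" "\<forall>f\<in>S. precedes e' f" by blast
    show ?case
    proof (cases "precedes e e'")
      case True
      with e' have "\<forall>f\<in>insert e S. precedes e f" by (fastforce simp: precedes_def)
      then show ?thesis by blast
    next
      case False
      then have "precedes e' e" by (auto simp: precedes_def)
      with e' show ?thesis by blast
    qed
  qed (simp add: precedes_def)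
  then show ?thesis by (auto simp: next_edge_def S_def)
qed

lemma fval_next_edge:
  assumes p: "progress es M" and lt: "\<rho> 2 < n" "\<rho> 3 < n"
  shows "fval n f_next_edge \<rho> M \<longleftrightarrow> next_edge es (v (\<rho> 2), v (\<rho> 3))"
proof -
  have todo: "M Todo i j = of_bool ((v i, v j) \<in> E - set es)" if "i < n" "j < n" for i j
    using p that by (simp add: progress_def)
  have data: "M Weight i j = m (v i, v j)" "M Rank i j = rank (v i, v j)"
    if "i < n" "j < n" "(v i, v j) \<in> E" for i j
    using p that by (simp_all add: progress_def encodes_def)
  have "fval n f_next_edge \<rho> M \<longleftrightarrow> (v (\<rho> 2), v (\<rho> 3)) \<in> E - set es \<and>
      \<not> (\<exists>i<n. \<exists>j<n. (v i, v j) \<in> E - set es \<and> (m (v (\<rho> 2), v (\<rho> 3)) < m (v i, v j) \<or>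
        m (v (\<rho> 2), v (\<rho> 3)) = m (v i, v j) \<and> rank (v i, v j) < rank (v (\<rho> 2), v (\<rho> 3))))"
    using lt by (simp add: f_next_edge_def todo data cong: conj_cong)
  also have "\<dots> \<longleftrightarrow> (v (\<rho> 2), v (\<rho> 3)) \<in> E - set es \<and>
      \<not> (\<exists>i<n. \<exists>j<n. (v i, v j) \<in> E - set es \<and> \<not> precedes (v (\<rho> 2), v (\<rho> 3)) (v i, v j))"
  proof -
    \<comment> \<open>The order is total, so failing to precede means coming strictly later, which
      comparisons can test.\<close>
    have "\<not> precedes e f \<longleftrightarrow> m e < m f \<or> m e = m f \<and> rank f < rank e" for e f
      by (auto simp: precedes_def)
    then show ?thesis by (simp only:)
  qed
  also have "\<dots> \<longleftrightarrow> next_edge es (v (\<rho> 2), v (\<rho> 3))"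
  proof -
    have "(\<exists>i<n. \<exists>j<n. (v i, v j) \<in> E - set es \<and> Q (v i, v j)) \<longleftrightarrow> (\<exists>f\<in>E - set es. Q f)" for Q
    proof -
      have "(\<exists>f\<in>E - set es. Q f) \<longleftrightarrow> (\<exists>a\<in>A. \<exists>b\<in>A. (a, b) \<in> E - set es \<and> Q (a, b))"
        using E_subset by auto
      then show ?thesis by (simp only: bex_A)
    qed
    from this[of "\<lambda>f. \<not> precedes (v (\<rho> 2), v (\<rho> 3)) f"] show ?thesis
      unfolding next_edge_def by blast
  qed
  finally show ?thesis .
qed

lemma progress_step:
  assumes p: "progress es M" and lt: "\<rho> 2 < n" "\<rho> 3 < n"
    and e: "next_edge es (v (\<rho> 2), v (\<rho> 3))"
  shows "progress (es @ [(v (\<rho> 2), v (\<rho> 3))]) (psem n (PSeq (PSet Todo 2 3 (Num 0)) p_step) \<rho> M)"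
proof -
  let ?e = "(v (\<rho> 2), v (\<rho> 3))"
  let ?M = "M(Todo := (M Todo)(\<rho> 2 := (M Todo (\<rho> 2))(\<rho> 3 := 0)))"
  have "encodes (fun_diagram A m es) M" using p by (simp add: progress_def)
  then have enc: "encodes (fun_diagram A m es) ?M" by (rule encodes_cong) simp_all
  have eE: "?e \<in> E" using e by (simp add: next_edge_def)
  note step = psem_p_step[OF enc lt eE]
  have psem: "psem n (PSeq (PSet Todo 2 3 (Num 0)) p_step) \<rho> M = psem n p_step \<rho> ?M" by simp
  have "encodes (fun_diagram A m (es @ [?e])) (psem n p_step \<rho> ?M)"
    using step(1) by (simp add: fun_diagram_def)
  moreover have "\<forall>i<n. \<forall>j<n. psem n p_step \<rho> ?M Todo i j = of_bool ((v i, v j) \<in> E - set (es @ [?e]))"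
    using p lt by (auto simp: step(2) progress_def)
  moreover have "psem n p_step \<rho> ?M Winner = (\<lambda>_ _. 0)"
    using p by (simp add: step(2) progress_def)
  ultimately show ?thesis
    using p e unfolding psem progress_def next_edge_def by (auto simp: sorted_wrt_append)
qed

text \<open>A sweep that appends nothing has tested all pairs against the same list es and found
  none to be next. Since a nonempty finite set has a first element in a total preorder, no edge can
  then be left.\<close>

lemma progress_sweep:
  assumes p: "progress es M"
  shows "\<exists>es'. progress es' (psem n p_sweep \<rho> M) \<and>
    (length es < length es' \<or> es' = es \<and> set es = E)"
proof -
  let ?body = "PIf f_next_edge (PSeq (PSet Todo 2 3 (Num 0)) p_step) PSkip"
  \<comment> \<open>Either the list has grown, or it is unchanged and the pairs in S, already
    visited, are known not to be next.\<close>
  define Q where "Q = (\<lambda>S M'. \<exists>es'. progress es' M' \<and>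
    (length es < length es' \<or> es' = es \<and> (\<forall>(i, j)\<in>S. \<not> next_edge es (v i, v j))))"
  have body: "Q (S \<union> {(i, j)}) (psem n ?body (\<rho>(2 := i, 3 := j)) M')"
    if ij: "i < n" "j < n" and Q: "Q S M'" for i j S M'
  proof -
    let ?\<rho> = "\<rho>(2 := i, 3 := j)"
    have lt: "?\<rho> 2 < n" "?\<rho> 3 < n" using ij by simp_all
    from Q obtain es' where es': "progress es' M'"
      "length es < length es' \<or> es' = es \<and> (\<forall>(i, j)\<in>S. \<not> next_edge es (v i, v j))"
      unfolding Q_def by blast
    note fv = fval_next_edge[OF es'(1) lt]
    show ?thesis
    proof (cases "next_edge es' (v (?\<rho> 2), v (?\<rho> 3))")
      case True
      have "psem n ?body ?\<rho> M' = psem n (PSeq (PSet Todo 2 3 (Num 0)) p_step) ?\<rho> M'"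
        by (simp only: psem.simps(4) fv True if_True)
      with progress_step[OF es'(1) lt True]
      have "progress (es' @ [(v (?\<rho> 2), v (?\<rho> 3))]) (psem n ?body ?\<rho> M')" by (simp only:)
      moreover have "length es < length (es' @ [(v (?\<rho> 2), v (?\<rho> 3))])" using es'(2) by auto
      ultimately have "\<exists>es'. progress es' (psem n ?body ?\<rho> M') \<and> length es < length es'" by blast
      then show ?thesis unfolding Q_def by blast
    next
      case False
      then have "psem n ?body ?\<rho> M' = M'" unfolding psem.simps(1,4) fv by simp
      with es' False show ?thesis unfolding Q_def by (intro exI[of _ es']) auto
    qed
  qed
  have row: "Q (S \<union> (\<Union>j\<in>set [0..<n]. {(i, j)})) (psem n (PFor 3 ?body) (\<rho>(2 := i)) M')"
    if "i < n" "Q S M'" for i S M'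
    unfolding psem.simps(5)
    by (rule fold_grow[where P = Q and ?S0.0 = "{}"]) (use that body in \<open>simp_all del: Un_insert_right\<close>)
  have "Q ({} \<union> (\<Union>i\<in>set [0..<n]. \<Union>j\<in>set [0..<n]. {(i, j)})) (psem n p_sweep \<rho> M)"
    unfolding p_sweep_def psem.simps(5)[of n 2]
    by (rule fold_grow[where P = Q and ?S0.0 = "{}"])
      (use p row in \<open>auto simp: Q_def simp del: psem.simps\<close>)
  then obtain es' where es': "progress es' (psem n p_sweep \<rho> M)"
    "length es < length es' \<or> es' = es \<and> (\<forall>i<n. \<forall>j<n. \<not> next_edge es (v i, v j))"
    unfolding Q_def by auto
  moreover have "set es = E" if none: "\<forall>i<n. \<forall>j<n. \<not> next_edge es (v i, v j)"
  proof (rule ccontr)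
    assume "set es \<noteq> E"
    then have "set es \<subset> E" using p by (auto simp: progress_def)
    then obtain a b where ab: "next_edge es (a, b)" using ex_next_edge by (metis surj_pair)
    then have "a \<in> A" "b \<in> A" using E_subset by (auto simp: next_edge_def)
    with ab none show False using v_surj by metis
  qed
  ultimately show ?thesis by blast
qed

lemma progress_sweeps:
  assumes "progress [] M"
  shows "\<exists>es. progress es (psem n (PFor 0 (PFor 1 p_sweep)) \<rho> M) \<and> set es = E"
proof -
  define Q where "Q = (\<lambda>k M'. \<exists>es. progress es M' \<and> (k \<le> length es \<or> set es = E))"
  have step: "Q (Suc k) (psem n p_sweep \<rho>' M')" if "Q k M'" for k \<rho>' M'
  proof -
    from that obtain es where es: "progress es M'" "k \<le> length es \<or> set es = E"
      unfolding Q_def by blast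
    from progress_sweep[OF es(1), of \<rho>'] obtain es' where es': "progress es' (psem n p_sweep \<rho>' M')"
      "length es < length es' \<or> es' = es \<and> set es = E" by blast
    have "Suc k \<le> length es' \<or> set es' = E"
    proof (cases "set es = E")
      case True
      \<comment> \<open>Once E is exhausted, a distinct list within E cannot be longer than es, so
        further sweeps are idle.\<close>
      have "distinct es" "distinct es'" "set es' \<subseteq> E" using es es' by (simp_all add: progress_def)
      then have "length es' \<le> length es"
        using True card_mono[OF finite_E] by (metis distinct_card)
      with es' show ?thesis by auto
    qed (use es es' in auto)
    with es' show ?thesis unfolding Q_def by blast
  qed
  have inner: "Q (k * n + n) (psem n (PFor 1 p_sweep) \<rho>' M')" if "Q (k * n) M'" for k \<rho>' M'
    unfolding psem.simps(5)[of n 1]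
    by (rule fold_upt_induct[where P = "\<lambda>l. Q (k * n + l)"]) (use that step in simp_all)
  have "Q (n * n) (psem n (PFor 0 (PFor 1 p_sweep)) \<rho> M)"
    unfolding psem.simps(5)[of n 0]
    by (rule fold_upt_induct[where P = "\<lambda>k. Q (k * n)"])
      (use assms inner in \<open>auto simp: Q_def add.commute simp del: psem.simps\<close>)
  then obtain es where es: "progress es (psem n (PFor 0 (PFor 1 p_sweep)) \<rho> M)"
    "n * n \<le> length es \<or> set es = E" unfolding Q_def by blast
  \<comment> \<open>E has at most n * n edges, so a distinct list of that length within E exhausts
    it.\<close>
  have "set es = E" if "n * n \<le> length es"
  proof (rule card_seteq[OF finite_E])
    show "set es \<subseteq> E" using es by (simp add: progress_def)
    show "card E \<le> card (set es)"
      using es(1) that card_E by (simp add: progress_def distinct_card)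
  qed
  with es show ?thesis by blast
qed

lemma psem_p_winners:
  assumes enc: "encodes F M"
  shows "psem n p_winners \<rho> M State = M State"
    and "M Winner = (\<lambda>_ _. 0) \<Longrightarrow> i < n \<Longrightarrow>
      psem n p_winners \<rho> M Winner i i = of_bool (v i \<in> winners A F)"
proof -
  define R where "R = (\<lambda>k M'. (\<forall>b. b \<noteq> Winner \<longrightarrow> M' b = M b) \<and>
    (\<forall>i<n. M' Winner i i = (if i < k \<and> v i \<in> winners A F then 1 else M Winner i i)))"
  have "R n (psem n p_winners \<rho> M)"
    unfolding p_winners_def psem.simps(5)
  proof (rule fold_upt_induct[where P = R])
    fix k M' assume k: "k < n" and R: "R k M'"
    have enc': "encodes F M'" by (rule encodes_cong[OF enc]) (use R in \<open>auto simp: R_def\<close>)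
    have lt: "(\<rho>(3 := k)) 3 < n" using k by simp
    have "fval n (FOr f_cycle_dominated f_not_dominated) (\<rho>(3 := k)) M' \<longleftrightarrow> v k \<in> winners A F"
      unfolding FOr_simps fval_cycle_dominated[of F M' "\<rho>(3 := k)", OF enc' lt]
        fval_not_dominated[of F M' "\<rho>(3 := k)", OF enc' lt]
      using k by (simp add: winners_def)
    then show "R (Suc k) (psem n (PIf (FOr f_cycle_dominated f_not_dominated)
        (PSet Winner 3 3 (Num 1)) PSkip) (\<rho>(3 := k)) M')"
      using R unfolding psem.simps(4) by (auto simp: R_def less_Suc_eq)
  qed (simp add: R_def)
  then show "psem n p_winners \<rho> M State = M State"
    and "M Winner = (\<lambda>_ _. 0) \<Longrightarrow> i < n \<Longrightarrow>
      psem n p_winners \<rho> M Winner i i = of_bool (v i \<in> winners A F)"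
    by (auto simp: R_def)
qed

text \<open>The witness for the processing order is the history of the run, which
  \<open>progress\<close> has kept sorted.\<close>

lemma psem_p_main:
  assumes "progress [] M"
  shows "\<exists>es. processing_order m E rank es \<and>
    (\<forall>i<n. \<forall>j<n. psem n p_main \<rho> M State i j = state_code (fun_diagram A m es (v i, v j))) \<and>
    (\<forall>i<n. psem n p_main \<rho> M Winner i i = of_bool (v i \<in> winners A (fun_diagram A m es)))"
proof -
  let ?M = "psem n (PFor 0 (PFor 1 p_sweep)) \<rho> M"
  from progress_sweeps[OF assms] obtain es where es: "progress es ?M" "set es = E" by blast
  then have enc: "encodes (fun_diagram A m es) ?M" and win: "?M Winner = (\<lambda>_ _. 0)"
    by (simp_all add: progress_def)
  have "processing_order m E rank es"
    using es by (auto simp: progress_def processing_order_def precedes_def[abs_def])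
  moreover have "psem n p_main \<rho> M = psem n p_winners \<rho> ?M"
    by (simp only: p_main_def psem.simps(3))
  ultimately show ?thesis
    using psem_p_winners[OF enc] win enc by (auto simp: encodes_def)
qed

end


section \<open>Input and output\<close>

definition offset :: "(nat \<Rightarrow> nat list) \<Rightarrow> nat \<Rightarrow> nat" where
  "offset adj i = (\<Sum>l<i. length (adj l))"

lemma offset_Suc: "offset adj (Suc i) = offset adj i + length (adj i)"
  by (simp add: offset_def)

lemma along_adj_Suc: "along_adj (Suc n) adj f = along_adj n adj f @ map (f n) (adj n)"
  by (simp add: along_adj_def)

lemma length_along_adj: "length (along_adj n adj f) = offset adj n"
  by (induction n) (simp_all add: along_adj_Suc offset_Suc along_adj_def[of 0] offset_def[of _ 0])

lemma nth_along_adj: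
  assumes "i < n" "j < length (adj i)"
  shows "offset adj i + j < offset adj n" "along_adj n adj f ! (offset adj i + j) = f i (adj i ! j)"
proof -
  have "offset adj i + j < offset adj n \<and> along_adj n adj f ! (offset adj i + j) = f i (adj i ! j)"
    using assms(1)
  proof (induction n)
    case (Suc n)
    then show ?case
      using assms(2)
      by (cases "i = n") (auto simp: along_adj_Suc offset_Suc nth_append length_along_adj)
  qed simp
  then show "offset adj i + j < offset adj n"
    "along_adj n adj f ! (offset adj i + j) = f i (adj i ! j)" by auto
qed

lemma along_adj_position:
  "q < offset adj n \<Longrightarrow> \<exists>i<n. \<exists>j<length (adj i). q = offset adj i + j"
proof (induction n)
  case (Suc n)
  show ?case
  proof (cases "q < offset adj n")
    case False
    with Suc.prems have "q - offset adj n < length (adj n)" "q = offset adj n + (q - offset adj n)"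
      by (auto simp: offset_Suc)
    then show ?thesis by blast
  qed (use Suc.IH less_Suc_eq in blast)
qed (simp add: offset_def)

definition list_position :: aexp where
  "list_position = Add (Get ''off'' (index 0)) (index 1)"

text \<open>Loops always run to n. A list of length at most n is traversed by n rounds, with a
  comparison against the start of the next list switching off the surplus ones.\<close>

definition adj_loop :: "com \<Rightarrow> com" where
  "adj_loop c = for_loop 0 (for_loop 1
     (Cond (Less list_position (Get ''off'' (Add (index 0) (Const 1)))) c Skip))"

definition loop_cost :: "nat poly \<Rightarrow> nat poly" where
  "loop_cost p = [:10:] + [:0, 1:] * (p + [:13:])"

lemma poly_loop_cost [simp]: "poly (loop_cost p) n = 10 + n * (poly p n + 13)"
  by (simp add: loop_cost_def)

text \<open>D is the set of list positions treated so far, and J must be indifferent to the loop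
  counters. The overhead 14 is the cost 12 of the test, the conditional node and the idle
  branch.\<close>

lemma terminates_adj_loop:
  assumes init: "J {} s"
    and n: "\<And>D s. J D s \<Longrightarrow> s ''n'' 0 = int n"
    and off: "\<And>D s i. J D s \<Longrightarrow> i \<le> n \<Longrightarrow> s ''off'' (int i) = int (offset adj i)"
    and idx: "\<And>D s k l. J D s \<Longrightarrow> J D (set_index k l s)"
    and len: "\<And>i. i < n \<Longrightarrow> length (adj i) \<le> n"
    and step: "\<And>D s i j. J D s \<Longrightarrow> i < n \<Longrightarrow> j < length (adj i) \<Longrightarrow> s ''i'' 0 = int i \<Longrightarrow>
      s ''i'' 1 = int j \<Longrightarrow> terminates c s T (\<lambda>s'. J (insert (i, j) D) s' \<and> s' ''i'' = s ''i'')"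
  shows "terminates (adj_loop c) s (poly (loop_cost (loop_cost [:T + 14:])) n)
    (J {(i, j). i < n \<and> j < length (adj i)})"
proof -
  \<comment> \<open>The bound by \<open>length (adj i)\<close> lets surplus rounds leave the set
    unchanged, so that a finished row agrees with the start of the next.\<close>
  define D where "D = (\<lambda>k l. {(i, j). i < k \<and> j < length (adj i)} \<union>
    {(i, j). i = k \<and> j < l \<and> j < length (adj i)})"
  define I where "I = (\<lambda>k s. J (D k 0) s \<and> s ''i'' 0 = int k)"
  define I' where "I' = (\<lambda>k l s. J (D k l) s \<and> s ''i'' 0 = int k \<and> s ''i'' 1 = int l)"
  let ?b = "Less list_position (Get ''off'' (Add (index 0) (Const 1)))"
  have D_Suc: "D k n = D (Suc k) 0" if "k < n" for k
    using len[OF that] by (auto simp: D_def less_Suc_eq)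
  have body: "terminates (Cond ?b c Skip) s (T + 14)
      (\<lambda>s'. s' ''i'' (int 1) = int l \<and> I' k (Suc l) (set_index 1 (Suc l) s'))"
    if kl: "k < n" "l < n" and I: "I' k l s" for k l s
  proof -
    have J: "J (D k l) s" and i: "s ''i'' 0 = int k" "s ''i'' 1 = int l"
      using I by (auto simp: I'_def)
    have b: "bval ?b s \<longleftrightarrow> l < length (adj k)"
      using off[OF J, of k] off[OF J, of "Suc k"] kl i
      by (simp add: list_position_def index_def offset_Suc add.commute)
    have "terminates (Cond ?b c Skip) s (1 + bcost ?b + T + 1)
        (\<lambda>s'. J (D k (Suc l)) s' \<and> s' ''i'' = s ''i'')"
    proof (rule terminates_Cond)
      assume "bval ?b s"
      then have l: "l < length (adj k)" using b by simp
      have "insert (k, l) (D k l) = D k (Suc l)" using l by (auto simp: D_def)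
      with step[OF J kl(1) l i] show "terminates c s T (\<lambda>s'. J (D k (Suc l)) s' \<and> s' ''i'' = s ''i'')"
        by simp
    next
      assume "\<not> bval ?b s"
      then have "D k (Suc l) = D k l" using b by (auto simp: D_def)
      with J show "terminates Skip s 1 (\<lambda>s'. J (D k (Suc l)) s' \<and> s' ''i'' = s ''i'')"
        by (intro terminates_Skip) simp
    qed
    then show ?thesis
      by (rule terminates_mono) (auto simp: list_position_def index_def I'_def i intro: idx)
  qed
  have row: "terminates (for_loop 1 (Cond ?b c Skip)) s (10 + n * (T + 14 + 13))
      (\<lambda>s'. s' ''i'' (int 0) = int k \<and> I (Suc k) (set_index 0 (Suc k) s'))"
    if k: "k < n" and I: "I k s" for k s
  proof -
    have "terminates (for_loop 1 (Cond ?b c Skip)) s (10 + n * (T + 14 + 13)) (I' k n)"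
    proof (rule terminates_for_loop)
      show "I' k 0 (set_index 1 0 s)" using I by (auto simp: I_def I'_def intro: idx)
    qed (use k n body in \<open>auto simp: I'_def\<close>)
    then show ?thesis
      by (rule terminates_mono) (auto simp: I_def I'_def D_Suc[OF k] intro: idx)
  qed
  have "terminates (adj_loop c) s (10 + n * (10 + n * (T + 14 + 13) + 13)) (I n)"
    unfolding adj_loop_def
  proof (rule terminates_for_loop)
    show "I 0 (set_index 0 0 s)" using init by (auto simp: I_def D_def intro: idx)
  qed (use n row in \<open>auto simp: I_def\<close>)
  then show ?thesis
    by (rule terminates_mono) (auto simp: I_def D_def)
qed

section \<open>Loading the matrices and storing the results\<close>

definition list_cell :: aexp where
  "list_cell = position (index 0) (Get ''head'' list_position)"

text \<open>Multiples of n are produced by repeated addition, starting from the zero that the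
  initial memory holds in \<open>row[0]\<close>.\<close>

definition load_rows :: com where
  "load_rows = for_loop 0 (Put ''row'' (Add (index 0) (Const 1))
     (Add (Get ''row'' (index 0)) (Get ''n'' (Const 0))))"

definition load_entry :: com where
  "load_entry = Seq (Put (mat_name Weight) list_cell (Get ''weight'' list_position))
     (Seq (Put (mat_name Rank) list_cell (Get ''rank'' list_position))
       (Put (mat_name Todo) list_cell (Const 1)))"

definition store_entry :: com where
  "store_entry = Put ''state'' list_position (Get (mat_name State) list_cell)"

definition store_winners :: com where
  "store_winners = for_loop 0
     (Put ''winner'' (index 0) (Get (mat_name Winner) (position (index 0) (index 0))))"

definition fun_program :: com where
  "fun_program = Seq load_rows (Seq (adj_loop load_entry) (Seq (compile p_main)
     (Seq (adj_loop store_entry) store_winners)))"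

text \<open>The 4 counts the sequencing nodes; 114 is a budget of 100 for one list entry plus the
  overhead 14 of \<open>adj_loop\<close>.\<close>

definition fun_program_cost :: "nat poly" where
  "fun_program_cost = [:4:] + loop_cost [:20:] + loop_cost (loop_cost [:114:]) + prog_cost p_main +
     loop_cost (loop_cost [:114:]) + loop_cost [:20:]"

locale numbered_adjacency = numbered_graph A E m rank v n
  for A :: "'a set" and E m rank v n +
  fixes adj :: "nat \<Rightarrow> nat list"
  assumes distinct_adj: "i < n \<Longrightarrow> distinct (adj i)"
    and set_adj: "i < n \<Longrightarrow> set (adj i) = {j. j < n \<and> (v i, v j) \<in> E}"
begin

abbreviation s0 :: state where
  "s0 \<equiv> input_state n v adj m rank"

lemma nth_adj: "i < n \<Longrightarrow> j < length (adj i) \<Longrightarrow> adj i ! j < n \<and> (v i, v (adj i ! j)) \<in> E"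
  using set_adj nth_mem by blast

lemma length_adj: "i < n \<Longrightarrow> length (adj i) \<le> n"
  using distinct_card[OF distinct_adj, of i] card_mono[of "{..<n}" "set (adj i)"] set_adj[of i]
  by auto

lemma input_off: "i \<le> n \<Longrightarrow> s0 ''off'' (int i) = int (offset adj i)"
  by (simp add: input_state_def array_of_def offset_def del: upt_Suc)

lemma input_lists:
  assumes "i < n" "j < length (adj i)"
  shows "s0 ''head'' (int (offset adj i + j)) = int (adj i ! j)"
    and "s0 ''weight'' (int (offset adj i + j)) = m (v i, v (adj i ! j))"
    and "s0 ''rank'' (int (offset adj i + j)) = rank (v i, v (adj i ! j))"
  using nth_along_adj[where n = n and adj = adj, OF assms]
  by (simp_all add: input_state_def array_of_def length_along_adj del: of_nat_add)

definition keeps_lists :: "state \<Rightarrow> bool" where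
  "keeps_lists s \<longleftrightarrow> (\<forall>a\<in>{''off'', ''head'', ''weight'', ''rank''}. s a = s0 a)"

lemma aval_list_position:
  assumes "keeps_lists s" "i < n" "s ''i'' 0 = int i" "s ''i'' 1 = int j"
  shows "aval list_position s = int (offset adj i + j)"
  using assms input_off[of i] by (simp add: list_position_def index_def keeps_lists_def)

lemma aval_list_cell:
  assumes "keeps_lists s" "represents n {} \<rho> M s" "i < n" "j < length (adj i)"
    "s ''i'' 0 = int i" "s ''i'' 1 = int j"
  shows "aval list_cell s = int (i * n + adj i ! j)"
  using assms aval_list_position[OF assms(1,3,5,6)] input_lists(1)[OF assms(3,4)]
  by (simp add: list_cell_def index_def position_def keeps_lists_def represents_def)

definition loaded :: "(nat \<times> nat) set \<Rightarrow> mats" where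
  "loaded D a i k = (if \<exists>j<length (adj i). (i, j) \<in> D \<and> adj i ! j = k
     then case a of Weight \<Rightarrow> m (v i, v k) | Rank \<Rightarrow> rank (v i, v k) | Todo \<Rightarrow> 1 | _ \<Rightarrow> 0 else 0)"

lemma terminates_load_rows:
  "terminates load_rows s0 (poly (loop_cost [:20:]) n)
    (\<lambda>s. represents n {} \<rho> (loaded {}) s \<and> keeps_lists s)"
proof -
  define I where "I = (\<lambda>k s. (\<forall>a. a \<noteq> ''i'' \<longrightarrow> a \<noteq> ''row'' \<longrightarrow> s a = s0 a) \<and> s ''i'' 0 = int k \<and>
    (\<forall>i\<le>k. s ''row'' (int i) = int (i * n)))"
  have n: "s0 ''n'' 0 = int n" and row: "s0 ''row'' 0 = 0" and mats: "s0 (mat_name a) = (\<lambda>_. 0)" for a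
    by (simp_all add: input_state_def array_of_def)
  have "terminates load_rows s0 (10 + n * (20 + 13)) (I n)"
    unfolding load_rows_def
  proof (rule terminates_for_loop)
    show "I 0 (set_index 0 0 s0)" using row by (auto simp: I_def)
  next
    fix k s assume I: "I k s"
    then have old: "s ''row'' (int k) = int (k * n)" "s ''n'' 0 = int n" "s ''i'' 0 = int k"
      using n by (auto simp: I_def)
    let ?s = "s(''row'' := (s ''row'')(int (Suc k) := int (Suc k * n)))"
    have "\<forall>i\<le>Suc k. ?s ''row'' (int i) = int (i * n)"
      using I unfolding I_def by (auto simp: le_Suc_eq simp del: of_nat_mult of_nat_Suc)
    then have "I (Suc k) (set_index 0 (Suc k) ?s)" using I unfolding I_def by simp
    moreover have "aval (Add (index 0) (Const 1)) s = int (Suc k)" using old by (simp add: index_def)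
    moreover have "aval (Add (Get ''row'' (index 0)) (Get ''n'' (Const 0))) s = int (Suc k * n)"
      using old by (simp add: index_def)
    ultimately show "terminates (Put ''row'' (Add (index 0) (Const 1))
        (Add (Get ''row'' (index 0)) (Get ''n'' (Const 0)))) s 20
        (\<lambda>s'. s' ''i'' (int 0) = int k \<and> I (Suc k) (set_index 0 (Suc k) s'))"
      using old(3) by (intro terminates_mono[OF terminates_Put])
        (simp_all only:, simp_all add: index_def)
  qed (use n in \<open>auto simp: I_def\<close>)
  then show ?thesis
    by (rule terminates_mono)
      (auto simp: I_def represents_def loaded_def keeps_lists_def n mats)
qed

lemma terminates_load:
  assumes "represents n {} \<rho> (loaded {}) s" "keeps_lists s"
  shows "terminates (adj_loop load_entry) s (poly (loop_cost (loop_cost [:114:])) n)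
    (\<lambda>s. represents n {} \<rho> (loaded {(i, j). i < n \<and> j < length (adj i)}) s \<and> keeps_lists s)"
proof -
  define J where "J = (\<lambda>D s. represents n {} \<rho> (loaded D) s \<and> keeps_lists s)"
  have "terminates load_entry s 100 (\<lambda>s'. J (insert (i, j) D) s' \<and> s' ''i'' = s ''i'')"
    if J: "J D s" and ij: "i < n" "j < length (adj i)" and i: "s ''i'' 0 = int i" "s ''i'' 1 = int j"
    for D s i j
  proof -
    let ?k = "adj i ! j"
    let ?put = "\<lambda>a z s. s(mat_name a := (s (mat_name a))(int (i * n + ?k) := z))"
    let ?putm = "\<lambda>a z M. M(a := (M a)(i := (M a i)(?k := z)))"
    define s1 where "s1 = ?put Weight (m (v i, v ?k)) s"
    define s2 where "s2 = ?put Rank (rank (v i, v ?k)) s1"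
    define s3 where "s3 = ?put Todo 1 s2"
    define M1 where "M1 = ?putm Weight (m (v i, v ?k)) (loaded D)"
    define M2 where "M2 = ?putm Rank (rank (v i, v ?k)) M1"
    define M3 where "M3 = ?putm Todo 1 M2"
    have k: "?k < n" using nth_adj ij by blast
    have r: "represents n {} \<rho> (loaded D) s" "keeps_lists s" using J by (auto simp: J_def)
    have r1: "represents n {} \<rho> M1 s1" "keeps_lists s1"
      unfolding s1_def M1_def
      by (rule represents_put[OF r(1) ij(1) k], use r(2) in \<open>simp add: keeps_lists_def\<close>)
    have r2: "represents n {} \<rho> M2 s2" "keeps_lists s2"
      unfolding s2_def M2_def
      by (rule represents_put[OF r1(1) ij(1) k], use r1(2) in \<open>simp add: keeps_lists_def\<close>)
    have r3: "represents n {} \<rho> M3 s3" "keeps_lists s3"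
      unfolding s3_def M3_def
      by (rule represents_put[OF r2(1) ij(1) k], use r2(2) in \<open>simp add: keeps_lists_def\<close>)
    have M3: "M3 = loaded (insert (i, j) D)"
    proof (intro ext)
      fix a i' k'
      show "M3 a i' k' = loaded (insert (i, j) D) a i' k'"
        using ij by (cases a) (auto simp: M3_def M2_def M1_def loaded_def)
    qed
    have i1: "s1 ''i'' = s ''i''" and i2: "s2 ''i'' = s ''i''" and i3: "s3 ''i'' = s ''i''"
      by (simp_all add: s1_def s2_def s3_def)
    have t1: "terminates (Put (mat_name Weight) list_cell (Get ''weight'' list_position)) s 30 (\<lambda>s'. s' = s1)"
      using aval_list_cell[OF r(2,1) ij i] aval_list_position[OF r(2) ij(1) i] input_lists(2)[OF ij] r(2)
      by (intro terminates_mono[OF terminates_Put])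
        (auto simp: s1_def keeps_lists_def list_cell_def list_position_def index_def position_def)
    have t2: "terminates (Put (mat_name Rank) list_cell (Get ''rank'' list_position)) s1 30 (\<lambda>s'. s' = s2)"
      using aval_list_cell[OF r1(2,1) ij] aval_list_position[OF r1(2) ij(1)] input_lists(3)[OF ij] r1(2) i i1
      by (intro terminates_mono[OF terminates_Put])
        (auto simp: s2_def keeps_lists_def list_cell_def list_position_def index_def position_def)
    have t3: "terminates (Put (mat_name Todo) list_cell (Const 1)) s2 30 (\<lambda>s'. s' = s3)"
      using aval_list_cell[OF r2(2,1) ij] r2(2) i i2
      by (intro terminates_mono[OF terminates_Put])
        (auto simp: s3_def list_cell_def list_position_def index_def position_def)
    have "terminates load_entry s (1 + 30 + (1 + 30 + 30)) (\<lambda>s'. s' = s3)"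
      unfolding load_entry_def
      by (rule terminates_Seq[OF t1], hypsubst, rule terminates_Seq[OF t2], hypsubst, rule t3)
    then show ?thesis
      by (rule terminates_mono) (use r3 M3 i3 in \<open>auto simp: J_def\<close>)
  qed
  then have "terminates (adj_loop load_entry) s (poly (loop_cost (loop_cost [:100 + 14:])) n)
      (J {(i, j). i < n \<and> j < length (adj i)})"
    by (intro terminates_adj_loop)
      (use assms input_off length_adj in
        \<open>auto simp: J_def keeps_lists_def represents_set_index represents_def\<close>)
  then show ?thesis by (simp add: J_def)
qed

lemma progress_loaded: "progress [] (loaded {(i, j). i < n \<and> j < length (adj i)})"
proof -
  have "(\<exists>j<length (adj i). (i, j) \<in> {(i, j). i < n \<and> j < length (adj i)} \<and> adj i ! j = k) \<longleftrightarrow>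
      (v i, v k) \<in> E" if "i < n" "k < n" for i k
  proof -
    have "(v i, v k) \<in> E \<longleftrightarrow> k \<in> set (adj i)" using set_adj that by simp
    then show ?thesis using that by (auto simp: in_set_conv_nth)
  qed
  then show ?thesis
    by (simp add: progress_def encodes_def loaded_def fun_diagram_def fun_eq_iff)
qed

lemma terminates_store:
  assumes "represents n {} \<rho> M s" "keeps_lists s"
  shows "terminates (adj_loop store_entry) s (poly (loop_cost (loop_cost [:114:])) n)
    (\<lambda>s. represents n {} \<rho> M s \<and>
      (\<forall>i<n. \<forall>j<length (adj i). s ''state'' (int (offset adj i + j)) = M State i (adj i ! j)))"
proof -
  define cs where "cs = along_adj n adj (M State)"
  define J where "J = (\<lambda>D s. represents n {} \<rho> M s \<and> keeps_lists s \<and>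
    (\<forall>(i, j)\<in>D. s ''state'' (int (offset adj i + j)) = cs ! (offset adj i + j)))"
  have "terminates store_entry s 100 (\<lambda>s'. J (insert (i, j) D) s' \<and> s' ''i'' = s ''i'')"
    if J: "J D s" and ij: "i < n" "j < length (adj i)" and i: "s ''i'' 0 = int i" "s ''i'' 1 = int j"
    for D s i j
  proof -
    have r: "represents n {} \<rho> M s" "keeps_lists s" using J by (auto simp: J_def)
    have k: "adj i ! j < n" using nth_adj ij by blast
    have cs: "cs ! (offset adj i + j) = M State i (adj i ! j)"
      using nth_along_adj[where n = n and adj = adj, OF ij] by (simp add: cs_def)
    have val: "s (mat_name State) (int (i * n + adj i ! j)) = M State i (adj i ! j)"
      using r k ij unfolding represents_def by blast
    let ?s = "s(''state'' := (s ''state'')(int (offset adj i + j) := M State i (adj i ! j)))"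
    have "represents n {} \<rho> M ?s"
      using r unfolding represents_def by (simp del: of_nat_add of_nat_mult)
    then have "J (insert (i, j) D) ?s"
      using J cs by (auto simp: J_def keeps_lists_def simp del: of_nat_add)
    then show ?thesis
      unfolding store_entry_def
      by (intro terminates_mono[OF terminates_Put])
        (simp_all only: aval.simps aval_list_cell[OF r(2,1) ij i] aval_list_position[OF r(2) ij(1) i] val,
          simp_all add: list_cell_def list_position_def index_def position_def)
  qed
  then have "terminates (adj_loop store_entry) s (poly (loop_cost (loop_cost [:100 + 14:])) n)
      (J {(i, j). i < n \<and> j < length (adj i)})"
    by (intro terminates_adj_loop)
      (use assms input_off length_adj in
        \<open>auto simp: J_def keeps_lists_def represents_set_index represents_def\<close>)
  then show ?thesis
    by (rule terminates_mono) (auto simp: J_def cs_def nth_along_adj simp del: of_nat_add)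
qed

lemma terminates_store_winners:
  assumes "represents n {} \<rho> M s"
  shows "terminates store_winners s (poly (loop_cost [:20:]) n)
    (\<lambda>s'. s' ''state'' = s ''state'' \<and> (\<forall>i<n. s' ''winner'' (int i) = M Winner i i))"
proof -
  define I where "I = (\<lambda>k s'. represents n {} \<rho> M s' \<and> s' ''i'' 0 = int k \<and> s' ''state'' = s ''state'' \<and>
    (\<forall>i<k. s' ''winner'' (int i) = M Winner i i))"
  have "terminates store_winners s (10 + n * (20 + 13)) (I n)"
    unfolding store_winners_def
  proof (rule terminates_for_loop)
    show "I 0 (set_index 0 0 s)" using assms by (auto simp: I_def represents_set_index)
  next
    fix k s' assume k: "k < n" and I: "I k s'"
    then have r: "represents n {} \<rho> M s'" by (simp add: I_def)
    have "s' (mat_name Winner) (int (k * n + k)) = M Winner k k"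
      using r k unfolding represents_def by blast
    moreover have "aval (position (index 0) (index 0)) s' = int (k * n + k)"
      using r I k by (simp add: position_def index_def represents_def I_def)
    ultimately have val: "aval (Get (mat_name Winner) (position (index 0) (index 0))) s' = M Winner k k"
      by simp
    let ?s = "s'(''winner'' := (s' ''winner'')(int k := M Winner k k))"
    have "represents n {} \<rho> M ?s"
      using r unfolding represents_def by (simp del: of_nat_add of_nat_mult)
    then have "I (Suc k) (set_index 0 (Suc k) ?s)"
      using I by (auto simp: I_def represents_set_index less_Suc_eq)
    moreover have "?s ''i'' (int 0) = int k" using I by (simp add: I_def)
    moreover have "aval (index 0) s' = int k" using I by (simp add: I_def index_def)
    ultimately show "terminates (Put ''winner'' (index 0) (Get (mat_name Winner) (position (index 0) (index 0)))) s' 20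
        (\<lambda>s''. s'' ''i'' (int 0) = int k \<and> I (Suc k) (set_index 0 (Suc k) s''))"
      by (intro terminates_mono[OF terminates_Put])
        (simp_all only: val, simp_all add: index_def position_def)
  qed (auto simp: I_def represents_def)
  then show ?thesis
    by (rule terminates_mono) (auto simp: I_def)
qed

lemma terminates_fun_program:
  "\<exists>es. processing_order m E rank es \<and>
    terminates fun_program s0 (poly fun_program_cost n)
      (\<lambda>s. outputs_diagram n v adj s (fun_diagram A m es) \<and>
        outputs_set n v s (winners A (fun_diagram A m es)))"
proof -
  define \<rho> :: env where "\<rho> = (\<lambda>_. 0)"
  define M where "M = psem n p_main \<rho> (loaded {(i, j). i < n \<and> j < length (adj i)})"
  from psem_p_main[OF progress_loaded, of \<rho>, folded M_def] obtain es where es: "processing_order m E rank es"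
    and St: "\<forall>i<n. \<forall>j<n. M State i j = state_code (fun_diagram A m es (v i, v j))"
    and W: "\<forall>i<n. M Winner i i = of_bool (v i \<in> winners A (fun_diagram A m es))"
    by blast
  \<comment> \<open>The adjacency lists are consulted again when the diagram is written out edge by
    edge, so they must outlive \<open>p_main\<close>.\<close>
  have frame: "keeps_lists s'" if "prog_frame s s'" "keeps_lists s" for s s'
    unfolding keeps_lists_def
  proof
    fix a assume a: "a \<in> {''off'', ''head'', ''weight'', ''rank''}"
    then have "a \<notin> range mat_name" by (auto simp del: mat_name.simps)
    moreover have "a \<noteq> ''i''" "a \<noteq> ''acc''" "a \<noteq> ''res''" using a by auto
    ultimately have "s' a = s a" using that(1) unfolding prog_frame_def by blast
    moreover have "s a = s0 a" using that(2) a unfolding keeps_lists_def by (rule bspec)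
    ultimately show "s' a = s0 a" by simp
  qed
  have "terminates fun_program s0
     (1 + poly (loop_cost [:20:]) n + (1 + poly (loop_cost (loop_cost [:114:])) n +
       (1 + poly (prog_cost p_main) n +
         (1 + poly (loop_cost (loop_cost [:114:])) n + poly (loop_cost [:20:]) n))))
     (\<lambda>s. (\<forall>i<n. \<forall>j<length (adj i). s ''state'' (int (offset adj i + j)) = M State i (adj i ! j)) \<and>
       (\<forall>i<n. s ''winner'' (int i) = M Winner i i))" (is "terminates _ _ _ ?Q")
    unfolding fun_program_def
  proof (rule terminates_Seq[OF terminates_load_rows[of \<rho>]])
    fix s1 assume s1: "represents n {} \<rho> (loaded {}) s1 \<and> keeps_lists s1"
    show "terminates (Seq (adj_loop load_entry) (Seq (compile p_main) (Seq (adj_loop store_entry) store_winners)))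
        s1 (1 + poly (loop_cost (loop_cost [:114:])) n + (1 + poly (prog_cost p_main) n +
         (1 + poly (loop_cost (loop_cost [:114:])) n + poly (loop_cost [:20:]) n))) ?Q"
    proof (rule terminates_Seq[OF terminates_load])
      fix s2 assume s2: "represents n {} \<rho> (loaded {(i, j). i < n \<and> j < length (adj i)}) s2 \<and> keeps_lists s2"
      show "terminates (Seq (compile p_main) (Seq (adj_loop store_entry) store_winners)) s2
          (1 + poly (prog_cost p_main) n +
            (1 + poly (loop_cost (loop_cost [:114:])) n + poly (loop_cost [:20:]) n)) ?Q"
      proof (rule terminates_Seq[OF terminates_compile[OF conjunct1[OF s2] pwf_p_main]], fold M_def)
        fix s3 assume s3: "represents n {} \<rho> M s3 \<and> prog_frame s2 s3"
        show "terminates (Seq (adj_loop store_entry) store_winners) s3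
            (1 + poly (loop_cost (loop_cost [:114:])) n + poly (loop_cost [:20:]) n) ?Q"
        proof (rule terminates_Seq[OF terminates_store])
          fix s4 assume s4: "represents n {} \<rho> M s4 \<and> (\<forall>i<n. \<forall>j<length (adj i).
            s4 ''state'' (int (offset adj i + j)) = M State i (adj i ! j))"
          from terminates_store_winners[OF conjunct1[OF s4]]
          show "terminates store_winners s4 (poly (loop_cost [:20:]) n) ?Q"
            by (rule terminates_mono) (use s4 in simp_all)
        qed (use s3 s2 frame in blast)+
      qed
    qed (use s1 in simp_all)
  qed
  then have "terminates fun_program s0 (poly fun_program_cost n)
      (\<lambda>s. outputs_diagram n v adj s (fun_diagram A m es) \<and>
        outputs_set n v s (winners A (fun_diagram A m es)))"
  proof (rule terminates_mono)
    fix s assume s: "(\<forall>i<n. \<forall>j<length (adj i). s ''state'' (int (offset adj i + j)) = M State i (adj i ! j)) \<and>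
       (\<forall>i<n. s ''winner'' (int i) = M Winner i i)"
    have "s ''state'' (int q) = along_adj n adj (\<lambda>i j. state_code (fun_diagram A m es (v i, v j))) ! q"
      if "q < offset adj n" for q
    proof -
      from along_adj_position[OF that] obtain i j
        where ij: "i < n" "j < length (adj i)" "q = offset adj i + j" by blast
      with s St nth_adj[OF ij(1,2)] show ?thesis by (simp add: nth_along_adj del: of_nat_add)
    qed
    then show "outputs_diagram n v adj s (fun_diagram A m es) \<and>
        outputs_set n v s (winners A (fun_diagram A m es))"
      using s W by (simp add: outputs_diagram_def outputs_set_def length_along_adj)
  qed (simp add: fun_program_cost_def)
  with es show ?thesis by blast
qed

end

text \<open>Program and polynomial are closed terms chosen before the election, its numbering and
  its lists, so the algorithm is uniform. The order es may depend on all of these, as it comes from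
  the run.\<close>

theorem theorem1:
  "\<exists>(c :: com) (T :: nat poly).
     \<forall>(A :: 'a set) P v adj rank.
       finite A \<and> profile A P \<and> adjacency_lists A (margin_edges A P) v adj \<longrightarrow>
       (\<exists>es t s. processing_order (margin P) (margin_edges A P) rank es \<and>
          exec c (input_state (card A) v adj (margin P) rank) t s \<and>
          t \<le> poly T (card A) \<and>
          outputs_diagram (card A) v adj s (fun_diagram A (margin P) es) \<and>
          outputs_set (card A) v s (winners A (fun_diagram A (margin P) es)))"
proof (intro exI[of _ fun_program] exI[of _ fun_program_cost] allI impI)
  fix A :: "'a set" and P v adj and rank :: "'a \<times> 'a \<Rightarrow> int"
  assume "finite A \<and> profile A P \<and> adjacency_lists A (margin_edges A P) v adj"
  then interpret numbered_adjacency A "margin_edges A P" "margin P" rank v "card A" adj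
    by unfold_locales (auto simp: adjacency_lists_def margin_edges_def)
  obtain es t s where "processing_order (margin P) (margin_edges A P) rank es"
    "exec fun_program (input_state (card A) v adj (margin P) rank) t s"
    "t \<le> poly fun_program_cost (card A)"
    "outputs_diagram (card A) v adj s (fun_diagram A (margin P) es)"
    "outputs_set (card A) v s (winners A (fun_diagram A (margin P) es))"
    using terminates_fun_program unfolding terminates_def by (elim exE conjE)
  then show "\<exists>es t s. processing_order (margin P) (margin_edges A P) rank es \<and>
          exec fun_program (input_state (card A) v adj (margin P) rank) t s \<and>
          t \<le> poly fun_program_cost (card A) \<and>
          outputs_diagram (card A) v adj s (fun_diagram A (margin P) es) \<and>
          outputs_set (card A) v s (winners A (fun_diagram A (margin P) es))"
    by (intro exI conjI)
qed

end
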